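(* Let $\alpha\in(0,2]$ and let $X$ be a real random variable having a unimodal and symmetric probability density function, such that the strength $s_\alpha(X)$ exists. For $\Delta>0$, let $\hat X_\Delta$ be the quantized version of $X$ with uniform quantization regions of length $\Delta$, i.e. $$\hat X_\Delta=k\Delta\quad\text{whenever}\quad X\in\left(k\Delta-\frac{\Delta}{2},\,k\Delta+\frac{\Delta}{2}\right],\qquad k\in\mathbb Z.$$ Then, as $\Delta\to0$, $$\frac{s_\alpha(X-\hat X_\Delta)}{\Delta}\longrightarrow s_\alpha(U),$$ where $U$ is a random variable uniformly distributed on $\left(-\frac12,\frac12\right)$.
   Context: Symmetric stable law: for $\alpha\in(0,2]$, $\gamma>0$, $S(\alpha,\gamma)$ is the law on $\mathbb R$ with characteristic function $\omega\mapsto \exp(-\gamma^\alpha|\omega|^\alpha)$ (for $\alpha=2$ this is $\mathcal N(0,2\gamma^2)$). Strength: let $\tilde Z_\alpha\sim S(\alpha,(1/\alpha)^{1/\alpha})$, with probability density $f_{\tilde Z_\alpha}$ and differential entropy $h(\tilde Z_\alpha)=-\int f_{\tilde Z_\alpha}\log f_{\tilde Z_\alpha}$. The strength ($\alpha$-power) of a real random variable $Y$ is $$s_\alpha(Y)=\inf\left\{s>0:\ -\mathbb E\left[\log f_{\tilde Z_\alpha}\!\left(\frac{Y}{s}\right)\right]\le h(\tilde Z_\alpha)\right\}.$$ It is said to exist when it is finite, i.e. when the set above is nonempty; this is guaranteed when $\mathbb E[\log(1+|Y|)]<\infty$ if $\alpha<2$, and when $\mathbb E[Y^2]<\infty$ if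 $\alpha=2$. *)

theory Defs
  imports "HOL-Probability.Probability"
begin

definition sym_stable :: "real \<Rightarrow> real \<Rightarrow> real measure" where
  "sym_stable \<alpha> \<gamma> =
     (THE M. real_distribution M \<and>
        char M = (\<lambda>\<omega>. complex_of_real (exp (- (\<gamma> powr \<alpha> * \<bar>\<omega>\<bar> powr \<alpha>)))))"

lemma sym_stable_eqI:
  assumes "real_distribution M"
    and "char M = (\<lambda>\<omega>. complex_of_real (exp (- (\<gamma> powr \<alpha> * \<bar>\<omega>\<bar> powr \<alpha>))))"
  shows "sym_stable \<alpha> \<gamma> = M"
  unfolding sym_stable_def
  by (rule the_equality) (use assms in \<open>auto intro!: Levy_uniqueness\<close>)

text \<open>
  The strength evaluates the density pointwise, possibly along a random variable with atoms, so a
  particular version of the density is needed: the continuous one.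
\<close>

definition sym_stable_density :: "real \<Rightarrow> real \<Rightarrow> real \<Rightarrow> real" where
  "sym_stable_density \<alpha> \<gamma> =
     (THE f. continuous_on UNIV f \<and> (\<forall>x. 0 \<le> f x) \<and>
        density lborel (\<lambda>x. ennreal (f x)) = sym_stable \<alpha> \<gamma>)"

lemma sym_stable_density_eqI:
  assumes f: "continuous_on UNIV f" "\<And>x. 0 \<le> f x"
      "density lborel (\<lambda>x. ennreal (f x)) = sym_stable \<alpha> \<gamma>"
  shows "sym_stable_density \<alpha> \<gamma> = f"
  unfolding sym_stable_density_def
proof (rule the_equality)
  show "continuous_on UNIV f \<and> (\<forall>x. 0 \<le> f x) \<and>
      density lborel (\<lambda>x. ennreal (f x)) = sym_stable \<alpha> \<gamma>"
    using f by blast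
next
  fix g :: "real \<Rightarrow> real"
  assume g: "continuous_on UNIV g \<and> (\<forall>x. 0 \<le> g x) \<and>
      density lborel (\<lambda>x. ennreal (g x)) = sym_stable \<alpha> \<gamma>"
  have m: "f \<in> borel_measurable borel" "g \<in> borel_measurable borel"
    using f g by (auto intro: borel_measurable_continuous_onI)
  have "AE x in lborel. ennreal (g x) = ennreal (f x)"
    using m f g by (intro sigma_finite_measure.density_unique sigma_finite_lborel) auto
  then have ae: "AE x in lborel. g x = f x"
    by eventually_elim (use f g in auto)
  show "g = f"
  proof (rule ccontr)
    assume "g \<noteq> f"
    then obtain x where x: "g x \<noteq> f x" by auto
    have "open {x. g x \<noteq> f x}"
      using f g by (intro open_Collect_neq) auto
    moreover from this have "{x. g x \<noteq> f x} \<in> null_sets lborel"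
      using ae by (subst AE_iff_null_sets) auto
    then have "{x. g x \<noteq> f x} \<in> null_sets lebesgue"
      by (rule null_sets_completionI)
    ultimately show False
      using x open_not_negligible by (auto simp: negligible_iff_null_sets)
  qed
qed

definition diff_entropy :: "(real \<Rightarrow> real) \<Rightarrow> real" where
  "diff_entropy f = - (LINT x|lborel. f x * ln (f x))"

abbreviation ref_density :: "real \<Rightarrow> real \<Rightarrow> real" where
  "ref_density \<alpha> \<equiv> sym_stable_density \<alpha> ((1 / \<alpha>) powr (1 / \<alpha>))"

text \<open>
  For \<open>0 < \<alpha> \<le> 2\<close> the reference density is strictly positive and bounded, so \<open>- ln (ref_density \<alpha> (Y / s))\<close> is
  bounded below and its expectation is always defined in the extended sense; it is infinite
  exactly when the function is not integrable, in which case \<open>s\<close> does not belong to the set.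
  The infimum is taken in the extended reals: it is infinite iff the set is empty.
\<close>

definition strength :: "real \<Rightarrow> 'a measure \<Rightarrow> ('a \<Rightarrow> real) \<Rightarrow> ereal" where
  "strength \<alpha> M Y =
     (INF s \<in> {s::real. 0 < s \<and>
         integrable M (\<lambda>\<omega>. ln (ref_density \<alpha> (Y \<omega> / s))) \<and>
         - (LINT \<omega>|M. ln (ref_density \<alpha> (Y \<omega> / s))) \<le> diff_entropy (ref_density \<alpha>)}.
       ereal s)"

text \<open>
  The mode itself is left out of the monotonicity conditions, so that real-valued densities that
  are unbounded near the mode are covered.
\<close>

definition unimodal :: "(real \<Rightarrow> real) \<Rightarrow> bool" where
  "unimodal f \<longleftrightarrow> (\<exists>m. mono_on {..<m} f \<and> antimono_on {m<..} f)"

definition quantize :: "real \<Rightarrow> real \<Rightarrow> real" where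
  "quantize \<Delta> x =
     of_int (THE k::int. x \<in> {of_int k * \<Delta> - \<Delta> / 2 <.. of_int k * \<Delta> + \<Delta> / 2}) * \<Delta>"

lemma quantize_region_iff:
  fixes x \<Delta> :: real
  assumes "\<Delta> > 0"
  shows "x \<in> {of_int k * \<Delta> - \<Delta> / 2 <.. of_int k * \<Delta> + \<Delta> / 2} \<longleftrightarrow> k = \<lceil>x / \<Delta> - 1 / 2\<rceil>"
proof -
  have "x \<in> {of_int k * \<Delta> - \<Delta> / 2 <.. of_int k * \<Delta> + \<Delta> / 2} \<longleftrightarrow>
      of_int k - 1 < x / \<Delta> - 1 / 2 \<and> x / \<Delta> - 1 / 2 \<le> of_int k"
    using assms by (auto simp: field_simps)
  also have "\<dots> \<longleftrightarrow> k = \<lceil>x / \<Delta> - 1 / 2\<rceil>"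
    by linarith
  finally show ?thesis .
qed

lemma quantize_eq:
  "\<Delta> > 0 \<Longrightarrow> x \<in> {of_int k * \<Delta> - \<Delta> / 2 <.. of_int k * \<Delta> + \<Delta> / 2} \<Longrightarrow>
    quantize \<Delta> x = of_int k * \<Delta>"
  unfolding quantize_def quantize_region_iff by simp

lemma quantize_ceiling: "\<Delta> > 0 \<Longrightarrow> quantize \<Delta> x = of_int \<lceil>x / \<Delta> - 1 / 2\<rceil> * \<Delta>"
  unfolding quantize_def quantize_region_iff by simp

end

(*
  The error X - quantize D X, divided by D, is the centred fractional part of X / D. Averaging over
  shifts of X by t * D, 0 <= t <= 1, leaves bounded test functions of it almost unchanged, because
  the unimodal even density f is L1-continuous under translation with an explicit modulus; the average
  over t is exactly the uniform mean. So E[L(error / (s * D))] tends to E[L(U / s)] for every s, where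
  L is the logarithm of the reference density. Both are monotone in s, the limit strictly, and this is
  enough for the infima to converge, whatever the value of the entropy threshold.

  What is needed of the reference density is that it is the continuous density of a genuine
  law, is positive, and strictly decreases in |x|. These come from Gaussian scale mixtures: with
  b = a / 2, exp (- (u powr b)) is a limit of powers of 1 - (1 - z) powr b at z = exp (- u / n powr (1 / b)),
  a power series in z with nonnegative coefficients (a rescaled sum of Sibuya variables), so its
  value at u = w^2 is a limit of nonnegative combinations of centred Gaussians in w, and so is its
  Fourier transform. The inequalities in gmix below survive pointwise limits, and they imply
  positivity and strict monotonicity.
*)
theory Submission
  imports Defs "HOL-Real_Asymp.Real_Asymp" "HOL-Computational_Algebra.Polynomial"
begin

section \<open>Limits of Gaussian scale mixtures\<close>

text \<open>The second condition says that \<open>q y = F (sqrt y)\<close> satisfies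
  \<open>0 \<le> q a * t\<^sup>2 + 2 * q ((a + b) / 2) * t + q b\<close> for all \<open>t\<close>: it encodes convexity of \<open>q\<close> (\<open>t = - 1\<close>)
  and log-convexity (discriminant) without division, hence passes to limits.\<close>

definition gmix :: "(real \<Rightarrow> real) \<Rightarrow> bool" where
  "gmix F \<longleftrightarrow> (\<forall>x y. \<bar>x\<bar> \<le> \<bar>y\<bar> \<longrightarrow> F y \<le> F x) \<and>
     (\<forall>x y m t. 2 * m\<^sup>2 = x\<^sup>2 + y\<^sup>2 \<longrightarrow> 0 \<le> F x * t\<^sup>2 + 2 * F m * t + F y)"

lemma gmix_antimono: "gmix F \<Longrightarrow> \<bar>x\<bar> \<le> \<bar>y\<bar> \<Longrightarrow> F y \<le> F x"
  unfolding gmix_def by blast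

lemma gmix_quadratic:
  "gmix F \<Longrightarrow> 2 * m\<^sup>2 = x\<^sup>2 + y\<^sup>2 \<Longrightarrow> 0 \<le> F x * t\<^sup>2 + 2 * F m * t + F y"
  unfolding gmix_def by blast

lemma gmix_nonneg: "gmix F \<Longrightarrow> 0 \<le> F x"
  using gmix_quadratic[of F x x x 0] by simp

lemma gmix_minus: "gmix F \<Longrightarrow> F (- x) = F x"
  using gmix_antimono[of F x "- x"] gmix_antimono[of F "- x" x] by simp

text \<open>A Gaussian is log-linear in the square of its argument, so its value at \<open>m\<close>
  is the geometric mean of those at \<open>x\<close> and \<open>y\<close>, and the form in
  \<open>t\<close> is \<open>C\<close> times the square of \<open>p * t + q\<close>.\<close>

lemma gmix_gaussian:
  assumes "0 \<le> C" "0 \<le> c"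
  shows "gmix (\<lambda>x. C * exp (- (c * x\<^sup>2)))"
  unfolding gmix_def
proof (intro conjI allI impI)
  fix x y :: real assume "\<bar>x\<bar> \<le> \<bar>y\<bar>"
  then have "x\<^sup>2 \<le> y\<^sup>2" by (rule power2_mono)
  then have "c * x\<^sup>2 \<le> c * y\<^sup>2"
    using assms(2) by (rule mult_left_mono)
  then show "C * exp (- (c * y\<^sup>2)) \<le> C * exp (- (c * x\<^sup>2))"
    using assms(1) by (intro mult_left_mono) simp_all
next
  fix x y m t :: real assume m: "2 * m\<^sup>2 = x\<^sup>2 + y\<^sup>2"
  define p q where "p = exp (- (c * x\<^sup>2) / 2)" and "q = exp (- (c * y\<^sup>2) / 2)"
  have p: "exp (- (c * x\<^sup>2)) = p\<^sup>2" and q: "exp (- (c * y\<^sup>2)) = q\<^sup>2"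
    unfolding p_def q_def by (simp_all flip: exp_double)
  have m2: "m\<^sup>2 = (x\<^sup>2 + y\<^sup>2) / 2" using m by simp
  have pq: "exp (- (c * m\<^sup>2)) = p * q"
    unfolding p_def q_def m2 exp_add[symmetric]
    by (rule arg_cong[where f = exp]) (simp add: field_simps)
  have "0 \<le> C * (p * t + q)\<^sup>2"
    using assms(1) by (rule mult_nonneg_nonneg) (rule zero_le_power2)
  also have "\<dots> = C * p\<^sup>2 * t\<^sup>2 + 2 * (C * (p * q)) * t + C * q\<^sup>2"
    by algebra
  finally show "0 \<le> C * exp (- (c * x\<^sup>2)) * t\<^sup>2 + 2 * (C * exp (- (c * m\<^sup>2))) * t + C * exp (- (c * y\<^sup>2))"
    unfolding p q pq .
qed

text \<open>For fixed \<open>t\<close> both conditions are linear in \<open>F\<close>; this is what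
  makes log-convexity stable under nonnegative combinations.\<close>

lemma gmix_cmult: "0 \<le> w \<Longrightarrow> gmix F \<Longrightarrow> gmix (\<lambda>x. w * F x)"
  unfolding gmix_def
proof (intro conjI allI impI; elim conjE)
  fix x y m t :: real
  assume w: "0 \<le> w" and *: "2 * m\<^sup>2 = x\<^sup>2 + y\<^sup>2"
    and F: "\<forall>x y m t. 2 * m\<^sup>2 = x\<^sup>2 + y\<^sup>2 \<longrightarrow> 0 \<le> F x * t\<^sup>2 + 2 * F m * t + F y"
  have "0 \<le> w * (F x * t\<^sup>2 + 2 * F m * t + F y)" using w F * by simp
  then show "0 \<le> w * F x * t\<^sup>2 + 2 * (w * F m) * t + w * F y" by (simp add: algebra_simps)
qed (simp add: mult_left_mono)

lemma gmix_add: "gmix F \<Longrightarrow> gmix G \<Longrightarrow> gmix (\<lambda>x. F x + G x)"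
  unfolding gmix_def
proof (intro conjI allI impI; elim conjE)
  fix x y m t :: real
  assume *: "2 * m\<^sup>2 = x\<^sup>2 + y\<^sup>2"
    and F: "\<forall>x y m t. 2 * m\<^sup>2 = x\<^sup>2 + y\<^sup>2 \<longrightarrow> 0 \<le> F x * t\<^sup>2 + 2 * F m * t + F y"
    and G: "\<forall>x y m t. 2 * m\<^sup>2 = x\<^sup>2 + y\<^sup>2 \<longrightarrow> 0 \<le> G x * t\<^sup>2 + 2 * G m * t + G y"
  have "0 \<le> (F x * t\<^sup>2 + 2 * F m * t + F y) + (G x * t\<^sup>2 + 2 * G m * t + G y)"
    by (intro add_nonneg_nonneg[of "F x * t\<^sup>2 + 2 * F m * t + F y"]) (use F G * in blast)+
  then show "0 \<le> (F x + G x) * t\<^sup>2 + 2 * (F m + G m) * t + (F y + G y)"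
    by (simp add: algebra_simps)
qed (simp add: add_mono)

lemma gmix_sum: "(\<And>i. i \<in> I \<Longrightarrow> gmix (F i)) \<Longrightarrow> gmix (\<lambda>x. \<Sum>i\<in>I. F i x)"
proof (induction I rule: infinite_finite_induct)
  case (insert i I)
  then show ?case by (simp add: gmix_add)
qed (simp_all add: gmix_def)

text \<open>Only weak inequalities between finitely many values of \<open>F\<close> are involved, so
  pointwise convergence is enough.\<close>

lemma gmix_limit:
  assumes "\<And>n. gmix (F n)" and "\<And>x. (\<lambda>n. F n x) \<longlonglongrightarrow> G x"
  shows "gmix G"
  unfolding gmix_def
proof (intro conjI allI impI)
  fix x y :: real assume "\<bar>x\<bar> \<le> \<bar>y\<bar>"
  then show "G y \<le> G x"
    using assms gmix_antimono by (intro LIMSEQ_le[OF assms(2) assms(2)]) auto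
next
  fix x y m t :: real assume "2 * m\<^sup>2 = x\<^sup>2 + y\<^sup>2"
  then have "0 \<le> F n x * t\<^sup>2 + 2 * F n m * t + F n y" for n
    using assms(1) gmix_quadratic by blast
  moreover have "(\<lambda>n. F n x * t\<^sup>2 + 2 * F n m * t + F n y) \<longlonglongrightarrow> G x * t\<^sup>2 + 2 * G m * t + G y"
    by (intro tendsto_intros assms)
  ultimately show "0 \<le> G x * t\<^sup>2 + 2 * G m * t + G y"
    by (intro LIMSEQ_le_const) auto
qed

text \<open>The squares of \<open>0\<close> and \<open>y\<close> have the square of
  \<open>y / sqrt 2\<close> as midpoint. When the constant term \<open>F y\<close> vanishes, the
  quadratic in \<open>t\<close> stays nonnegative only if its linear coefficient vanishes
  too.\<close>

lemma gmix_zero_step: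
  assumes "gmix F" "F y = 0"
  shows "F (y / sqrt 2) = 0"
proof (rule antisym)
  define m where "m = y / sqrt 2"
  have m: "2 * m\<^sup>2 = 0\<^sup>2 + y\<^sup>2" by (simp add: m_def power_divide)
  have q: "0 \<le> F 0 * t\<^sup>2 + 2 * F m * t" for t
    using gmix_quadratic[OF assms(1) m, of t] assms(2) by simp
  show "F (y / sqrt 2) \<le> 0"
  proof (rule ccontr)
    assume "\<not> ?thesis"
    then have pos: "F m > 0" by (simp add: m_def)
    have F0: "F 0 \<ge> F m" using gmix_antimono[OF assms(1), of 0 m] by simp
    \<comment> \<open>This \<open>t\<close> minimises the quadratic; \<open>F 0\<close> is nonzero
      because it is at least \<open>F m\<close>.\<close>
    have "0 \<le> F 0 * (- F m / F 0)\<^sup>2 + 2 * F m * (- F m / F 0)" by (rule q)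
    also have "\<dots> = - (F m)\<^sup>2 / F 0" using pos F0 by (simp add: field_simps power2_eq_square)
    also have "\<dots> < 0" using pos F0 by simp
    finally show False by simp
  qed
qed (rule gmix_nonneg[OF assms(1)])

text \<open>A zero at \<open>x\<close> propagates to all \<open>x / sqrt 2 ^ n\<close>, hence by
  continuity to the origin.\<close>

lemma gmix_pos:
  assumes F: "gmix F" and c: "isCont F 0" and "F 0 > 0"
  shows "F x > 0"
proof (rule ccontr)
  assume "\<not> F x > 0"
  then have x: "F x = 0" using gmix_nonneg[OF F, of x] by simp
  have "F (x / sqrt 2 ^ n) = 0" for n
  proof (induction n)
    case (Suc n)
    then have "F (x / sqrt 2 ^ n / sqrt 2) = 0" by (rule gmix_zero_step[OF F])
    then show ?case by (simp add: mult.commute)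
  qed (simp add: x)
  moreover have "(\<lambda>n. F (x / sqrt 2 ^ n)) \<longlonglongrightarrow> F 0"
    by (rule isCont_tendsto_compose[OF c]) real_asymp
  ultimately have "F 0 = 0" by (simp add: LIMSEQ_const_iff)
  with assms show False by simp
qed

text \<open>As a function of the square of its argument, \<open>F\<close> is convex and
  nonincreasing. Once two values agree it cannot decrease any more, which contradicts positivity
  together with the limit zero.\<close>

lemma gmix_strict_antimono:
  assumes F: "gmix F" and pos: "\<And>x. F x > 0" and lim: "(F \<longlongrightarrow> 0) at_top"
    and "0 \<le> x" "x < y"
  shows "F y < F x"
proof (rule ccontr)
  assume "\<not> F y < F x"
  moreover have "F y \<le> F x" using gmix_antimono[OF F, of x y] assms by simp
  ultimately have eq: "F y = F x" by simp
  define d where "d = y\<^sup>2 - x\<^sup>2"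
  have d: "d > 0" using assms by (simp add: d_def power_strict_mono)
  \<comment> \<open>By convexity in \<open>x\<^sup>2\<close>, \<open>F\<close> is constant from \<open>x\<close> on.\<close>
  define z where "z n = sqrt (x\<^sup>2 + real n * d)" for n
  have z2: "(z n)\<^sup>2 = x\<^sup>2 + real n * d" for n
    using d by (simp add: z_def)
  have "F (z n) = F x \<and> F (z (Suc n)) = F x" for n
  proof (induction n)
    case 0
    then show ?case using assms eq by (simp add: z_def d_def)
  next
    case (Suc n)
    \<comment> \<open>With \<open>t = - 1\<close> this is a second difference along
      \<open>z\<close>; the preceding first difference vanishes, so the next value is at least
      \<open>F x\<close>.\<close>
    have "0 \<le> F (z n) * (-1)\<^sup>2 + 2 * F (z (Suc n)) * (-1) + F (z (Suc (Suc n)))"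
      by (rule gmix_quadratic[OF F]) (simp add: z2 algebra_simps)
    moreover have "z n \<le> z (Suc (Suc n))" "0 \<le> z n" 
      using d by (auto simp: z_def)
    then have "F (z (Suc (Suc n))) \<le> F (z n)"
      by (intro gmix_antimono[OF F]) auto
    ultimately show ?case using Suc by simp
  qed
  then have "F (z n) = F x" for n by blast
  moreover have "filterlim z at_top sequentially"
    unfolding z_def using d by real_asymp
  then have "(\<lambda>n. F (z n)) \<longlonglongrightarrow> 0"
    by (rule filterlim_compose[OF lim])
  ultimately have "F x = 0" by (simp add: LIMSEQ_const_iff)
  with pos[of x] show False by simp
qed

section \<open>Cosine transforms of the stable characteristic functions\<close>

text \<open>For an even function this is the Fourier transform, kept real-valued so that
  \<open>gmix\<close> can be stated for it.\<close>

definition cos_transform :: "(real \<Rightarrow> real) \<Rightarrow> real \<Rightarrow> real" where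
  "cos_transform \<phi> x = (LINT w|lborel. \<phi> w * cos (w * x))"

text \<open>Real part of the characteristic function of the standard normal law, after rescaling and
  removal of the normalising constant.\<close>

lemma gaussian_cos:
  assumes "c > 0"
  shows "has_bochner_integral lborel (\<lambda>w. exp (- (c * w\<^sup>2)) * cos (w * x))
           (sqrt (pi / c) * exp (- (x\<^sup>2 / (4 * c))))"
proof -
  have std: "has_bochner_integral lborel (\<lambda>y. std_normal_density y * cos (t * y)) (exp (- (t\<^sup>2) / 2))" for t
  proof -
    have i: "integrable lborel (\<lambda>y. std_normal_density y *\<^sub>R iexp (t * y))"
      by (rule Bochner_Integration.integrable_bound[where f = std_normal_density])
        (auto intro!: integrable_normal_density)
    have "char std_normal_distribution t = (LINT y|lborel. std_normal_density y *\<^sub>R iexp (t * y))"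
      unfolding char_def by (subst integral_density) auto
    then have "(LINT y|lborel. std_normal_density y *\<^sub>R iexp (t * y)) = complex_of_real (exp (- (t\<^sup>2) / 2))"
      by (simp add: char_std_normal_distribution)
    then have "has_bochner_integral lborel (\<lambda>y. Re (std_normal_density y *\<^sub>R iexp (t * y)))
        (Re (complex_of_real (exp (- (t\<^sup>2) / 2))))"
      using i by (intro has_bochner_integral_Re) (simp add: has_bochner_integral_iff)
    then show ?thesis by (simp add: Re_exp)
  qed
  \<comment> \<open>The substitution \<open>y = s * w\<close> turns the standard normal exponent
    \<open>y^2 / 2\<close> into \<open>c * w^2\<close>.\<close>
  define s where "s = sqrt (2 * c)"
  have s: "s > 0" "s\<^sup>2 = 2 * c" using assms by (auto simp: s_def)
  have "has_bochner_integral lborel (\<lambda>w. std_normal_density (0 + s * w) * cos (x / s * (0 + s * w)))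
     (exp (- ((x / s)\<^sup>2) / 2) /\<^sub>R \<bar>s\<bar>)"
    using std[of "x / s"] s by (subst lborel_has_bochner_integral_real_affine_iff[symmetric]) auto
  from has_bochner_integral_mult_right[OF this, of "sqrt (2 * pi)"]
  show ?thesis
  proof (rule back_subst[where P = "\<lambda>u. u"], intro arg_cong2[where f="has_bochner_integral lborel"] ext)
    fix w
    have "(s * w)\<^sup>2 / 2 = c * w\<^sup>2" using s by (simp add: power_mult_distrib)
    then show "sqrt (2 * pi) * (std_normal_density (0 + s * w) * cos (x / s * (0 + s * w))) =
        exp (- (c * w\<^sup>2)) * cos (w * x)"
      using s by (simp add: std_normal_density_def mult.commute)
  next
    have "sqrt (2 * pi) / s = sqrt (pi / c)"
      using assms by (simp add: s_def real_sqrt_divide real_sqrt_mult)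
    moreover have "(x / s)\<^sup>2 / 2 = x\<^sup>2 / (4 * c)" using s by (simp add: power_divide)
    moreover have "sqrt (2 * pi) * (E /\<^sub>R \<bar>s\<bar>) = sqrt (2 * pi) / s * E" for E
      using s(1) by (simp add: divide_inverse)
    ultimately show "sqrt (2 * pi) * (exp (- ((x / s)\<^sup>2) / 2) /\<^sub>R \<bar>s\<bar>) =
        sqrt (pi / c) * exp (- (x\<^sup>2 / (4 * c)))"
      by (metis minus_divide_left)
  qed
qed

text \<open>Dominated convergence with \<open>\<bar>cos (w * x)\<bar> \<le> 1\<close>. The
  hypotheses are stated almost everywhere so that \<open>w = 0\<close>, where the argument of the
  Sibuya series reaches \<open>1\<close>, can be left out.\<close>

lemma cos_transform_tendsto:
  assumes "integrable lborel g" "\<phi> \<in> borel_measurable borel" "\<And>n. \<psi> n \<in> borel_measurable borel"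
    and "\<And>n. AE w in lborel. \<bar>\<psi> n w\<bar> \<le> g w" "AE w in lborel. (\<lambda>n. \<psi> n w) \<longlonglongrightarrow> \<phi> w"
  shows "(\<lambda>n. cos_transform (\<psi> n) x) \<longlonglongrightarrow> cos_transform \<phi> x"
  unfolding cos_transform_def
proof (rule integral_dominated_convergence[where w = g])
  show "(\<lambda>w. \<phi> w * cos (w * x)) \<in> borel_measurable lborel"
    using assms(2) by simp
  show "(\<lambda>w. \<psi> n w * cos (w * x)) \<in> borel_measurable lborel" for n
    using assms(3)[of n] by simp
  show "AE w in lborel. (\<lambda>n. \<psi> n w * cos (w * x)) \<longlonglongrightarrow> \<phi> w * cos (w * x)"
    using assms(5) by eventually_elim (intro tendsto_intros)
  show "AE w in lborel. norm (\<psi> n w * cos (w * x)) \<le> g w" for n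
    using assms(4)[of n]
  proof eventually_elim
    case (elim w)
    have "norm (\<psi> n w * cos (w * x)) \<le> \<bar>\<psi> n w\<bar> * 1"
      unfolding real_norm_def abs_mult by (intro mult_left_mono) auto
    with elim show ?case by simp
  qed
qed (rule assms(1))

text \<open>Expanding the polynomial gives a nonnegative combination of Gaussians in
  \<open>w\<close>, whose transforms are Gaussians in \<open>x\<close>. The factor with
  \<open>\<delta>\<close> makes the constant term of \<open>P\<close> integrable as well.\<close>

lemma gmix_poly_gaussian:
  assumes P: "\<And>i. 0 \<le> coeff P i" and "0 \<le> c" "0 < \<delta>"
  shows "gmix (cos_transform (\<lambda>w. poly P (exp (- (c * w\<^sup>2))) * exp (- (\<delta> * w\<^sup>2))))"
proof -
  define d where "d i = real i * c + \<delta>" for i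
  have d: "d i > 0" for i using assms by (simp add: d_def add_nonneg_pos)
  have e: "poly P (exp (- (c * w\<^sup>2))) * exp (- (\<delta> * w\<^sup>2)) * cos (w * x) =
      (\<Sum>i\<le>degree P. coeff P i * (exp (- (d i * w\<^sup>2)) * cos (w * x)))" for w x
  proof -
    have "exp (- (c * w\<^sup>2)) ^ i * exp (- (\<delta> * w\<^sup>2)) = exp (- (d i * w\<^sup>2))" for i
      unfolding exp_of_nat_mult[symmetric] exp_add[symmetric] by (simp add: d_def algebra_simps)
    then have "coeff P i * exp (- (c * w\<^sup>2)) ^ i * exp (- (\<delta> * w\<^sup>2)) * cos (w * x) =
        coeff P i * (exp (- (d i * w\<^sup>2)) * cos (w * x))" for i
      by (metis mult.assoc)
    then show ?thesis
      unfolding poly_altdef sum_distrib_right by (rule sum.cong[OF refl])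
  qed
  have "has_bochner_integral lborel
      (\<lambda>w. poly P (exp (- (c * w\<^sup>2))) * exp (- (\<delta> * w\<^sup>2)) * cos (w * x))
      (\<Sum>i\<le>degree P. coeff P i * (sqrt (pi / d i) * exp (- (x\<^sup>2 / (4 * d i)))))" for x
    unfolding e by (intro has_bochner_integral_sum has_bochner_integral_mult_right gaussian_cos d)
  then have "cos_transform (\<lambda>w. poly P (exp (- (c * w\<^sup>2))) * exp (- (\<delta> * w\<^sup>2))) x =
      (\<Sum>i\<le>degree P. coeff P i * (sqrt (pi / d i) * exp (- (1 / (4 * d i) * x\<^sup>2))))" for x
    unfolding cos_transform_def by (simp add: has_bochner_integral_iff)
  moreover have "gmix (\<lambda>x. \<Sum>i\<le>degree P. coeff P i * (sqrt (pi / d i) * exp (- (1 / (4 * d i) * x\<^sup>2))))"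
    using d P by (intro gmix_sum gmix_cmult gmix_gaussian) (auto intro: less_imp_le)
  ultimately show ?thesis
    by presburger
qed

section \<open>The Sibuya power series and its scaling limit\<close>

text \<open>The coefficients of the power series of \<open>1 - (1 - z) powr \<beta>\<close>
  (the probabilities of the Sibuya distribution).\<close>

definition sibuya :: "real \<Rightarrow> nat \<Rightarrow> real" where
  "sibuya \<beta> k = (if k = 0 then 0 else - ((\<beta> gchoose k) * (- 1) ^ k))"

text \<open>For \<open>k \<ge> 1\<close> the coefficient is \<beta> (1 - \<beta>) (2 - \<beta>) ...
  (k - 1 - \<beta>) / k!, and none of these factors is negative.\<close>

lemma sibuya_nonneg:
  assumes "0 < \<beta>" "\<beta> \<le> 1"
  shows "0 \<le> sibuya \<beta> k"
proof (cases k)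
  case (Suc j)
  have "pochhammer (1 - \<beta>) j \<ge> 0"
    unfolding pochhammer_prod using assms by (intro prod_nonneg) auto
  then have "0 \<le> \<beta> * pochhammer (1 - \<beta>) j / fact k"
    using assms by simp
  also have "\<dots> = - ((\<beta> gchoose k) * (- 1) ^ k)"
  proof -
    have "(- 1) ^ k * ((- 1) ^ k :: real) = 1"
      by (simp flip: power_mult_distrib)
    then have "x * (- 1) ^ k * ((- 1) ^ k :: real) = x" for x
      by (metis mult.assoc mult.right_neutral)
    then show ?thesis
      unfolding gbinomial_pochhammer
      by (simp add: Suc pochhammer_rec mult.commute mult.left_commute)
  qed
  finally show ?thesis by (simp add: sibuya_def Suc)
qed (simp add: sibuya_def)

text \<open>Newton's binomial series for \<open>(1 - z) powr \<beta>\<close>, subtracted from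
  \<open>1\<close>.\<close>

lemma sibuya_sums:
  assumes "0 \<le> z" "z < 1"
  shows "(\<lambda>k. sibuya \<beta> k * z ^ k) sums (1 - (1 - z) powr \<beta>)"
proof -
  have "(\<lambda>k. (if k = 0 then 1 else 0) - (\<beta> gchoose k) * (- z) ^ k) sums (1 - (1 + - z) powr \<beta>)"
    using assms by (intro sums_diff gen_binomial_real sums_single[of 0 "\<lambda>_. 1", simplified]) auto
  moreover have "(if k = 0 then 1 else 0) - (\<beta> gchoose k) * (- z) ^ k = sibuya \<beta> k * z ^ k" for k
    by (simp add: sibuya_def power_minus[of z])
  ultimately show ?thesis by simp
qed

lemma coeff_power_nonneg:
  fixes P :: "real poly"
  assumes "\<And>i. 0 \<le> coeff P i"
  shows "0 \<le> coeff (P ^ n) i"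
  by (induction n arbitrary: i)
    (auto simp: coeff_mult coeff_1 intro!: sum_nonneg mult_nonneg_nonneg assms)

lemma integrable_gaussian:
  assumes "0 < c"
  shows "integrable lborel (\<lambda>w::real. exp (- (c * w\<^sup>2)))"
  using gaussian_cos[OF assms, of 0] by (simp add: has_bochner_integral_iff)

text \<open>Truncating the series gives polynomials with nonnegative coefficients. Their values at
  the Gaussian lie between \<open>0\<close> and \<open>1\<close>, so the factor with
  \<open>\<delta>\<close> dominates them all and the truncation can be removed under the
  transform.\<close>

lemma gmix_sibuya_gaussian:
  assumes "0 < \<beta>" "\<beta> \<le> 1" "0 < c" "0 < \<delta>"
  shows "gmix (cos_transform (\<lambda>w. (1 - (1 - exp (- (c * w\<^sup>2))) powr \<beta>) ^ n * exp (- (\<delta> * w\<^sup>2))))"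
proof (rule gmix_limit)
  define P where "P N = (\<Sum>k<N. monom (sibuya \<beta> k) k)" for N
  have "coeff (P N) i \<ge> 0" for N i
    unfolding P_def coeff_sum by (intro sum_nonneg) (simp add: sibuya_nonneg assms)
  then show "gmix (cos_transform (\<lambda>w. poly (P N ^ n) (exp (- (c * w\<^sup>2))) * exp (- (\<delta> * w\<^sup>2))))" for N
    using assms by (intro gmix_poly_gaussian coeff_power_nonneg) auto
  have poly_P: "poly (P N) z = (\<Sum>k<N. sibuya \<beta> k * z ^ k)" for N z
    by (simp add: P_def poly_sum poly_monom)
  have z: "0 \<le> exp (- (c * w\<^sup>2))" "exp (- (c * w\<^sup>2)) < 1" if "w \<noteq> 0" for w
    using assms that by auto
  show "(\<lambda>N. cos_transform (\<lambda>w. poly (P N ^ n) (exp (- (c * w\<^sup>2))) * exp (- (\<delta> * w\<^sup>2))) x)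
      \<longlonglongrightarrow> cos_transform (\<lambda>w. (1 - (1 - exp (- (c * w\<^sup>2))) powr \<beta>) ^ n * exp (- (\<delta> * w\<^sup>2))) x" for x
  proof (rule cos_transform_tendsto[OF integrable_gaussian[OF assms(4)]])
    show "AE w in lborel. \<bar>poly (P N ^ n) (exp (- (c * w\<^sup>2))) * exp (- (\<delta> * w\<^sup>2))\<bar> \<le> exp (- (\<delta> * w\<^sup>2))" for N
      using AE_lborel_singleton[of 0]
    proof eventually_elim
      case (elim w)
      let ?z = "exp (- (c * w\<^sup>2))"
      have n: "0 \<le> sibuya \<beta> k * ?z ^ k" for k
        using sibuya_nonneg[OF assms(1,2)] by simp
      \<comment> \<open>Nonnegative terms keep every partial sum below the full sum.\<close>
      have "poly (P N) ?z \<le> 1 - (1 - ?z) powr \<beta>"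
        unfolding poly_P sums_unique[OF sibuya_sums[OF z[OF elim]]]
        using sums_summable[OF sibuya_sums[OF z[OF elim]]] n by (intro sum_le_suminf) auto
      also have "\<dots> \<le> 1" by simp
      finally have "poly (P N) ?z \<le> 1" .
      moreover have "0 \<le> poly (P N) ?z"
        unfolding poly_P using n by (intro sum_nonneg) auto
      ultimately have "\<bar>poly (P N ^ n) ?z\<bar> \<le> 1"
        by (simp add: power_le_one)
      then show ?case
        using mult_right_mono[of "\<bar>poly (P N ^ n) ?z\<bar>" 1 "exp (- (\<delta> * w\<^sup>2))"]
        unfolding abs_mult by simp
    qed
    show "AE w in lborel. (\<lambda>N. poly (P N ^ n) (exp (- (c * w\<^sup>2))) * exp (- (\<delta> * w\<^sup>2)))
        \<longlonglongrightarrow> (1 - (1 - exp (- (c * w\<^sup>2))) powr \<beta>) ^ n * exp (- (\<delta> * w\<^sup>2))"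
      using AE_lborel_singleton[of 0]
    proof eventually_elim
      case (elim w)
      have "(\<lambda>N. poly (P N) (exp (- (c * w\<^sup>2)))) \<longlonglongrightarrow> 1 - (1 - exp (- (c * w\<^sup>2))) powr \<beta>"
        using sibuya_sums[OF z[OF elim], of \<beta>] by (simp add: poly_P sums_def)
      then show ?case
        unfolding poly_power by (intro tendsto_intros)
    qed
    show "(\<lambda>w. poly (P N ^ n) (exp (- (c * w\<^sup>2))) * exp (- (\<delta> * w\<^sup>2))) \<in> borel_measurable borel" for N
      unfolding poly_power poly_P by measurable
  qed measurable
qed

text \<open>Near \<open>t = 0\<close> the expression \<open>1 - exp (- (u * t))\<close> behaves like
  \<open>u * t\<close>, so \<open>y n\<close> is close to \<open>u powr \<beta> / Suc n\<close>, and
  the claim becomes the limit of \<open>(1 - a / n) ^ n\<close> with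
  \<open>a = u powr \<beta>\<close>.\<close>

lemma sibuya_limit:
  fixes u \<beta> :: real
  assumes "0 < u" "0 < \<beta>"
  shows "(\<lambda>n. (1 - (1 - exp (- (u * real (Suc n) powr (- 1 / \<beta>)))) powr \<beta>) ^ Suc n)
     \<longlonglongrightarrow> exp (- (u powr \<beta>))"
proof -
  \<comment> \<open>The scale is chosen so that \<open>t n powr \<beta> = 1 / Suc n\<close>.\<close>
  define t where "t n = real (Suc n) powr (- 1 / \<beta>)" for n
  define y where "y n = (1 - exp (- (u * t n))) powr \<beta>" for n
  have t_pos: "t n > 0" for n by (simp add: t_def)
  have z: "0 < 1 - exp (- (u * t n))" for n using assms t_pos[of n] by simp
  have y_pos: "y n > 0" for n using assms t_pos[of n] by (simp add: y_def)
  have y_less: "y n < 1" for n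
    using z[of n] assms powr_less_mono2[of \<beta> "1 - exp (- (u * t n))" 1] by (simp add: y_def)
  have "t \<longlonglongrightarrow> 0"
    unfolding t_def using assms
    by (intro tendsto_neg_powr filterlim_compose[OF filterlim_real_sequentially filterlim_Suc]) auto
  then have t: "filterlim t (at_right 0) sequentially"
    using t_pos by (intro tendsto_imp_filterlim_at_right) auto
  have "((\<lambda>t. (1 - exp (- (u * t))) / t) \<longlongrightarrow> u) (at_right 0)" by real_asymp
  from tendsto_powr[OF filterlim_compose[OF this t] tendsto_const[of \<beta>]] assms
  have "(\<lambda>n. ((1 - exp (- (u * t n))) / t n) powr \<beta>) \<longlonglongrightarrow> u powr \<beta>" by simp
  moreover have "((1 - exp (- (u * t n))) / t n) powr \<beta> = real (Suc n) * y n" for n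
  proof -
    have "t n powr \<beta> = inverse (real (Suc n))"
    proof -
      have "- 1 / \<beta> * \<beta> = - 1" using assms by simp
      then show ?thesis
        unfolding t_def powr_powr by (simp add: powr_minus del: of_nat_Suc)
    qed
    then show ?thesis
      using z[of n] t_pos[of n]
      by (subst powr_divide) (simp_all add: y_def divide_inverse mult.commute del: of_nat_Suc)
  qed
  ultimately have ny: "(\<lambda>n. real (Suc n) * y n) \<longlonglongrightarrow> u powr \<beta>" by simp
  \<comment> \<open>Dividing the convergent sequence \<open>Suc n * y n\<close> by
    \<open>Suc n\<close> shows that \<open>y\<close> itself tends to zero.\<close>
  have "(\<lambda>n. real (Suc n) * y n * inverse (real (Suc n))) \<longlonglongrightarrow> u powr \<beta> * 0"
    by (intro tendsto_mult ny LIMSEQ_inverse_real_of_nat)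
  moreover have "real (Suc n) * y n * inverse (real (Suc n)) = y n" for n
    by (simp del: of_nat_Suc)
  ultimately have "y \<longlonglongrightarrow> 0" by (simp only: mult_zero_right)
  then have y: "filterlim y (at_right 0) sequentially"
    using y_pos by (intro tendsto_imp_filterlim_at_right) auto
  have "((\<lambda>y::real. ln (1 - y) / y) \<longlongrightarrow> - 1) (at_right 0)" by real_asymp
  from tendsto_mult[OF ny filterlim_compose[OF this y]]
  have "(\<lambda>n. exp (real (Suc n) * y n * (ln (1 - y n) / y n))) \<longlonglongrightarrow> exp (u powr \<beta> * - 1)"
    by (rule tendsto_exp)
  moreover have "exp (real (Suc n) * y n * (ln (1 - y n) / y n)) = (1 - y n) ^ Suc n" for n
  proof -
    have "real (Suc n) * y n * (ln (1 - y n) / y n) = real (Suc n) * ln (1 - y n)"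
      using y_pos[of n] by simp
    then show ?thesis
      using y_less[of n] by (simp only: exp_of_nat_mult exp_ln diff_gt_0_iff_gt)
  qed
  ultimately show ?thesis by (simp add: y_def t_def)
qed

section \<open>Stable characteristic functions and the shape of their transforms\<close>

definition stable_cf :: "real \<Rightarrow> real \<Rightarrow> real \<Rightarrow> real" where
  "stable_cf \<alpha> \<gamma> w = exp (- (\<gamma> powr \<alpha> * \<bar>w\<bar> powr \<alpha>))"

lemma stable_cf_measurable [measurable]: "stable_cf \<alpha> \<gamma> \<in> borel_measurable borel"
  unfolding stable_cf_def by measurable

lemma stable_cf_nonneg: "0 \<le> stable_cf \<alpha> \<gamma> w"
  by (simp add: stable_cf_def)

lemma stable_cf_le_1: "stable_cf \<alpha> \<gamma> w \<le> 1"
  by (simp add: stable_cf_def)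

lemma stable_cf_minus: "stable_cf \<alpha> \<gamma> (- w) = stable_cf \<alpha> \<gamma> w"
  by (simp add: stable_cf_def)

lemma isCont_stable_cf: "0 < \<alpha> \<Longrightarrow> isCont (stable_cf \<alpha> \<gamma>) w"
  unfolding stable_cf_def by (intro continuous_intros) auto

text \<open>A multiple of \<open>1 / (1 + w^2)\<close> dominates: a stretched exponential decays
  faster than any power, however small \<open>\<alpha>\<close> is.\<close>

lemma integrable_stable_cf:
  assumes "0 < \<alpha>" "0 < \<gamma>"
  shows "integrable lborel (stable_cf \<alpha> \<gamma>)"
proof -
  define c where "c = \<gamma> powr \<alpha>"
  have c: "c > 0" using assms by (simp add: c_def)
  have "((\<lambda>x. exp (- (c * x powr \<alpha>)) * (1 + x\<^sup>2)) \<longlongrightarrow> 0) at_top"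
    using c assms by real_asymp
  then have "\<forall>\<^sub>F x in at_top. exp (- (c * x powr \<alpha>)) * (1 + x\<^sup>2) < 1"
    by (rule order_tendstoD) simp
  then obtain K where K: "exp (- (c * x powr \<alpha>)) * (1 + x\<^sup>2) < 1" if "x \<ge> K" for x
    unfolding eventually_at_top_linorder by blast
  \<comment> \<open>Beyond \<open>K\<close> the product is below \<open>1\<close> by the limit just
    taken; elsewhere \<open>stable_cf\<close> is at most \<open>1\<close> and
    \<open>w^2 \<le> K^2\<close>.\<close>
  have bound: "stable_cf \<alpha> \<gamma> w * (1 + w\<^sup>2) \<le> 1 + K\<^sup>2" for w
  proof (cases "\<bar>w\<bar> \<ge> K")
    case True
    then show ?thesis using K[of "\<bar>w\<bar>"] by (simp add: stable_cf_def c_def add_increasing2 less_imp_le)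
  next
    case False
    then have "w\<^sup>2 \<le> K\<^sup>2" by (intro power2_mono) auto
    moreover have "stable_cf \<alpha> \<gamma> w * (1 + w\<^sup>2) \<le> 1 * (1 + w\<^sup>2)"
      by (intro mult_right_mono stable_cf_le_1) simp
    ultimately show ?thesis by simp
  qed
  have "integrable lborel (\<lambda>w. (1 + K\<^sup>2) * inverse (1 + w\<^sup>2))"
    using integrable_inverse_1_plus_square by (simp add: set_integrable_def)
  then show ?thesis
  proof (rule Bochner_Integration.integrable_bound)
    show "AE w in lborel. norm (stable_cf \<alpha> \<gamma> w) \<le> norm ((1 + K\<^sup>2) * inverse (1 + w\<^sup>2))"
    proof (intro always_eventually allI)
      fix w :: real
      have "1 + w\<^sup>2 > 0" by (simp add: add_pos_nonneg)
      then have "stable_cf \<alpha> \<gamma> w \<le> (1 + K\<^sup>2) / (1 + w\<^sup>2)"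
        using bound[of w] by (simp add: pos_le_divide_eq)
      then show "norm (stable_cf \<alpha> \<gamma> w) \<le> norm ((1 + K\<^sup>2) * inverse (1 + w\<^sup>2))"
        using stable_cf_nonneg[of \<alpha> \<gamma> w] by (simp add: divide_inverse)
    qed
  qed simp
qed

text \<open>Two limits in succession. With a Gaussian factor as integrable majorant, the Sibuya
  powers converge to the characteristic function; then the Gaussian factor is sent to
  \<open>1\<close>, with the characteristic function itself as majorant.\<close>

lemma gmix_stable:
  assumes "0 < \<alpha>" "\<alpha> \<le> 2" "0 < \<gamma>"
  shows "gmix (cos_transform (stable_cf \<alpha> \<gamma>))"
proof (rule gmix_limit)
  define \<beta> where "\<beta> = \<alpha> / 2"
  have \<beta>: "0 < \<beta>" "\<beta> \<le> 1" using assms by (auto simp: \<beta>_def)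
  have reg: "gmix (cos_transform (\<lambda>w. stable_cf \<alpha> \<gamma> w * exp (- (\<delta> * w\<^sup>2))))" if \<delta>: "0 < \<delta>" for \<delta>
  proof (rule gmix_limit)
    \<comment> \<open>With this \<open>c n\<close> the Sibuya limit is taken at
      \<open>u = \<gamma>^2 * w^2\<close>, and \<open>u powr (\<alpha> / 2)\<close> is the stable
      exponent.\<close>
    define c where "c n = \<gamma>\<^sup>2 * real (Suc n) powr (- 1 / \<beta>)" for n
    have c: "c n > 0" for n using assms by (simp add: c_def)
    show "gmix (cos_transform
        (\<lambda>w. (1 - (1 - exp (- (c n * w\<^sup>2))) powr \<beta>) ^ Suc n * exp (- (\<delta> * w\<^sup>2))))" for n
      by (intro gmix_sibuya_gaussian \<beta> c \<delta>)
    show "(\<lambda>n. cos_transform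
        (\<lambda>w. (1 - (1 - exp (- (c n * w\<^sup>2))) powr \<beta>) ^ Suc n * exp (- (\<delta> * w\<^sup>2))) x)
      \<longlonglongrightarrow> cos_transform (\<lambda>w. stable_cf \<alpha> \<gamma> w * exp (- (\<delta> * w\<^sup>2))) x" for x
    proof (rule cos_transform_tendsto[OF integrable_gaussian[OF \<delta>]])
      show "AE w in lborel. \<bar>(1 - (1 - exp (- (c n * w\<^sup>2))) powr \<beta>) ^ Suc n * exp (- (\<delta> * w\<^sup>2))\<bar>
          \<le> exp (- (\<delta> * w\<^sup>2))" for n
      proof (intro always_eventually allI)
        fix w :: real
        let ?y = "(1 - exp (- (c n * w\<^sup>2))) powr \<beta>"
        have "?y \<le> 1" using \<beta> c[of n] by (intro powr_le1) auto
        then have "\<bar>(1 - ?y) ^ Suc n\<bar> \<le> 1"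
          unfolding power_abs by (intro power_le_one) auto
        then show "\<bar>(1 - ?y) ^ Suc n * exp (- (\<delta> * w\<^sup>2))\<bar> \<le> exp (- (\<delta> * w\<^sup>2))"
          using mult_right_mono[of "\<bar>(1 - ?y) ^ Suc n\<bar>" 1 "exp (- (\<delta> * w\<^sup>2))"]
          unfolding abs_mult[of "_ ^ Suc n"] by simp
      qed
      show "AE w in lborel. (\<lambda>n. (1 - (1 - exp (- (c n * w\<^sup>2))) powr \<beta>) ^ Suc n * exp (- (\<delta> * w\<^sup>2)))
          \<longlonglongrightarrow> stable_cf \<alpha> \<gamma> w * exp (- (\<delta> * w\<^sup>2))"
        using AE_lborel_singleton[of 0]
      proof eventually_elim
        case (elim w)
        have "(\<gamma>\<^sup>2 * w\<^sup>2) powr \<beta> = \<gamma> powr \<alpha> * \<bar>w\<bar> powr \<alpha>"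
        proof -
          have "\<gamma>\<^sup>2 = \<gamma> powr 2" "w\<^sup>2 = \<bar>w\<bar> powr 2" using assms elim by (simp_all)
          then show ?thesis by (simp only: powr_mult powr_powr \<beta>_def) simp
        qed
        moreover have "0 < \<gamma>\<^sup>2 * w\<^sup>2" using assms elim by simp
        ultimately show ?case
          using sibuya_limit[of "\<gamma>\<^sup>2 * w\<^sup>2" \<beta>] \<beta> unfolding c_def stable_cf_def
          by (intro tendsto_mult tendsto_const) (simp add: mult_ac)
      qed
    qed measurable
  qed
  show "gmix (cos_transform (\<lambda>w. stable_cf \<alpha> \<gamma> w * exp (- (inverse (real (Suc n)) * w\<^sup>2))))" for n
    by (rule reg) simp
  show "(\<lambda>n. cos_transform (\<lambda>w. stable_cf \<alpha> \<gamma> w * exp (- (inverse (real (Suc n)) * w\<^sup>2))) x)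
      \<longlonglongrightarrow> cos_transform (stable_cf \<alpha> \<gamma>) x" for x
  proof (rule cos_transform_tendsto[OF integrable_stable_cf[OF assms(1,3)]])
    show "AE w in lborel. \<bar>stable_cf \<alpha> \<gamma> w * exp (- (inverse (real (Suc n)) * w\<^sup>2))\<bar> \<le> stable_cf \<alpha> \<gamma> w" for n
    proof (intro always_eventually allI)
      fix w :: real
      have "exp (- (inverse (real (Suc n)) * w\<^sup>2)) \<le> 1" by simp
      then show "\<bar>stable_cf \<alpha> \<gamma> w * exp (- (inverse (real (Suc n)) * w\<^sup>2))\<bar> \<le> stable_cf \<alpha> \<gamma> w"
        using stable_cf_nonneg[of \<alpha> \<gamma> w] by (simp add: abs_mult mult_left_le)
    qed
    show "AE w in lborel. (\<lambda>n. stable_cf \<alpha> \<gamma> w * exp (- (inverse (real (Suc n)) * w\<^sup>2)))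
        \<longlonglongrightarrow> stable_cf \<alpha> \<gamma> w"
    proof (intro always_eventually allI)
      fix w :: real
      have "(\<lambda>n. stable_cf \<alpha> \<gamma> w * exp (- (inverse (real (Suc n)) * w\<^sup>2)))
          \<longlonglongrightarrow> stable_cf \<alpha> \<gamma> w * exp (- (0 * w\<^sup>2))"
        by (intro tendsto_intros LIMSEQ_inverse_real_of_nat)
      then show "(\<lambda>n. stable_cf \<alpha> \<gamma> w * exp (- (inverse (real (Suc n)) * w\<^sup>2)))
          \<longlonglongrightarrow> stable_cf \<alpha> \<gamma> w" by simp
    qed
  qed measurable
qed

section \<open>Fourier inversion and the stable densities\<close>

lemma isCont_cos_transform:
  assumes "integrable lborel \<phi>"
  shows "isCont (cos_transform \<phi>) x"
proof (rule continuous_at_sequentiallyI)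
  fix u :: "nat \<Rightarrow> real" assume u: "u \<longlonglongrightarrow> x"
  have m: "\<phi> \<in> borel_measurable borel"
    using borel_measurable_integrable[OF assms] by simp
  show "(\<lambda>n. cos_transform \<phi> (u n)) \<longlonglongrightarrow> cos_transform \<phi> x"
    unfolding cos_transform_def
  proof (rule integral_dominated_convergence[where w = "\<lambda>w. \<bar>\<phi> w\<bar>"])
    show "AE w in lborel. (\<lambda>n. \<phi> w * cos (w * u n)) \<longlonglongrightarrow> \<phi> w * cos (w * x)"
      by (intro always_eventually allI tendsto_intros u)
    show "AE w in lborel. norm (\<phi> w * cos (w * u n)) \<le> \<bar>\<phi> w\<bar>" for n
      by (intro always_eventually allI) (simp add: abs_mult mult_left_le)
    show "integrable lborel (\<lambda>w. \<bar>\<phi> w\<bar>)" using assms by simp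
  qed (use m in simp_all)
qed

text \<open>A majorant in product form supplies the absolute integrability required by both later
  uses of Fubini's theorem.\<close>

lemma integrable_product_bound:
  fixes F :: "real \<times> real \<Rightarrow> real"
  assumes "integrable lborel f" "integrable lborel g"
    and F: "F \<in> borel_measurable borel" and bound: "\<And>x y. \<bar>F (x, y)\<bar> \<le> f x * g y"
  shows "integrable (lborel \<Otimes>\<^sub>M lborel) F"
proof -
  have m: "F \<in> borel_measurable (lborel \<Otimes>\<^sub>M lborel)"
    using F by (simp add: lborel_prod)
  have [measurable]: "f \<in> borel_measurable borel" "g \<in> borel_measurable borel"
    using assms(1,2)[THEN borel_measurable_integrable] by simp_all
  have "integrable (lborel \<Otimes>\<^sub>M lborel) (\<lambda>p. f (fst p) * g (snd p))"
  proof (rule lborel_pair.Fubini_integrable)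
    show "integrable lborel (\<lambda>x. LINT y|lborel. norm (f (fst (x, y)) * g (snd (x, y))))"
      using assms(1,2) by (simp add: abs_mult)
    show "AE x in lborel. integrable lborel (\<lambda>y. f (fst (x, y)) * g (snd (x, y)))"
      using assms(2) by simp
  qed measurable
  then show ?thesis
  proof (rule Bochner_Integration.integrable_bound[OF _ m])
    show "AE p in lborel \<Otimes>\<^sub>M lborel. norm (F p) \<le> norm (f (fst p) * g (snd p))"
      by (intro always_eventually allI) (metis abs_ge_self bound order_trans prod.collapse real_norm_def)
  qed
qed

text \<open>The Gaussian factor makes the double integral absolutely convergent, so that Fubini applies.\<close>

lemma cos_transform_gaussian_inversion:
  assumes \<phi>: "integrable lborel \<phi>" and s: "0 < s"
  shows "integrable lborel (\<lambda>x. cos_transform \<phi> x * cos (t * x) * exp (- (s\<^sup>2 / 4 * x\<^sup>2)))"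
    and "(LINT x|lborel. cos_transform \<phi> x * cos (t * x) * exp (- (s\<^sup>2 / 4 * x\<^sup>2))) =
      sqrt pi * ((LINT v|lborel. \<phi> (t + s * v) * exp (- v\<^sup>2)) +
                 (LINT v|lborel. \<phi> (- t + s * v) * exp (- v\<^sup>2)))"
proof -
  \<comment> \<open>Since \<open>4 * e = s^2\<close>, the substitution
    \<open>w = - a + s * v\<close> turns the transform \<open>h\<close> of the Gaussian factor into
    a multiple of \<open>exp (- v^2)\<close>.\<close>
  define e where "e = s\<^sup>2 / 4"
  have e: "e > 0" using s by (simp add: e_def)
  have [measurable]: "\<phi> \<in> borel_measurable borel"
    using borel_measurable_integrable[OF \<phi>] by simp
  define F where "F w x = \<phi> w * cos (w * x) * cos (t * x) * exp (- (e * x\<^sup>2))" for w x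
  have F: "integrable (lborel \<Otimes>\<^sub>M lborel) (case_prod F)"
  proof (rule integrable_product_bound[where f = "\<lambda>w. \<bar>\<phi> w\<bar>" and g = "\<lambda>x. exp (- (e * x\<^sup>2))"])
    show "case_prod F \<in> borel_measurable borel"
      unfolding F_def by (subst borel_prod[symmetric]) measurable
    fix w x
    have "\<bar>cos (w * x)\<bar> * \<bar>cos (t * x)\<bar> \<le> 1" by (intro mult_le_one) auto
    then have "\<bar>\<phi> w\<bar> * exp (- (e * x\<^sup>2)) * (\<bar>cos (w * x)\<bar> * \<bar>cos (t * x)\<bar>)
        \<le> \<bar>\<phi> w\<bar> * exp (- (e * x\<^sup>2)) * 1"
      by (intro mult_left_mono) auto
    then show "\<bar>case (w, x) of (w, x) \<Rightarrow> F w x\<bar> \<le> \<bar>\<phi> w\<bar> * exp (- (e * x\<^sup>2))"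
      by (simp add: F_def abs_mult mult_ac)
  qed (use \<phi> e integrable_gaussian in auto)
  have inner: "(LINT w|lborel. F w x) = cos_transform \<phi> x * cos (t * x) * exp (- (e * x\<^sup>2))" for x
    unfolding F_def cos_transform_def by simp
  define h where "h u = sqrt (pi / e) * exp (- (u\<^sup>2 / (4 * e)))" for u
  have outer: "(LINT x|lborel. F w x) = \<phi> w / 2 * (h (w - t) + h (w + t))" for w
  proof -
    have "has_bochner_integral lborel
        (\<lambda>x. \<phi> w / 2 * (exp (- (e * x\<^sup>2)) * cos (x * (w - t)) + exp (- (e * x\<^sup>2)) * cos (x * (w + t))))
        (\<phi> w / 2 * (h (w - t) + h (w + t)))"
      unfolding h_def
      by (intro has_bochner_integral_mult_right has_bochner_integral_add gaussian_cos e)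
    moreover have "\<phi> w / 2 * (exp (- (e * x\<^sup>2)) * cos (x * (w - t)) + exp (- (e * x\<^sup>2)) * cos (x * (w + t))) = F w x" for x
    proof -
      \<comment> \<open>The product-to-sum formula leaves two Gaussian cosine transforms, which as
        functions of \<open>w\<close> are centred at \<open>t\<close> and
        \<open>- t\<close>.\<close>
      have "cos (x * (w - t)) + cos (x * (w + t)) = 2 * cos (w * x) * cos (t * x)"
        by (simp add: right_diff_distrib distrib_left cos_add cos_diff mult.commute)
      then have "\<phi> w / 2 * exp (- (e * x\<^sup>2)) * (cos (x * (w - t)) + cos (x * (w + t))) = F w x"
        unfolding F_def by simp
      then show ?thesis by (simp add: algebra_simps)
    qed
    ultimately have "has_bochner_integral lborel (F w) (\<phi> w / 2 * (h (w - t) + h (w + t)))"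
      by (simp only:)
    then show ?thesis by (rule has_bochner_integral_integral_eq)
  qed
  show "integrable lborel (\<lambda>x. cos_transform \<phi> x * cos (t * x) * exp (- (s\<^sup>2 / 4 * x\<^sup>2)))"
    using lborel_pair.integrable_snd[OF F] by (simp add: inner e_def)
  have h_int: "integrable lborel (\<lambda>w. \<phi> w * h (w + a))"
    and h_eq: "(LINT w|lborel. \<phi> w * h (w + a)) = 2 * sqrt pi * (LINT v|lborel. \<phi> (- a + s * v) * exp (- v\<^sup>2))" for a
  proof -
    have "integrable lborel (\<lambda>w. sqrt (pi / e) * \<bar>\<phi> w\<bar>)" using \<phi> by simp
    then show "integrable lborel (\<lambda>w. \<phi> w * h (w + a))"
    proof (rule Bochner_Integration.integrable_bound)
      show "AE w in lborel. norm (\<phi> w * h (w + a)) \<le> norm (sqrt (pi / e) * \<bar>\<phi> w\<bar>)"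
      proof (intro always_eventually allI)
        fix w
        have "\<bar>h (w + a)\<bar> \<le> sqrt (pi / e) * 1"
          unfolding h_def abs_mult using e by (intro mult_mono) auto
        then have "\<bar>\<phi> w\<bar> * \<bar>h (w + a)\<bar> \<le> \<bar>\<phi> w\<bar> * (sqrt (pi / e) * 1)"
          by (rule mult_left_mono) simp
        then show "norm (\<phi> w * h (w + a)) \<le> norm (sqrt (pi / e) * \<bar>\<phi> w\<bar>)"
          using e by (simp add: abs_mult mult.commute)
      qed
    qed (unfold h_def, measurable)
    have c: "s * sqrt (pi / e) = 2 * sqrt pi"
      using s real_sqrt_mult[of pi "2\<^sup>2"] by (simp add: e_def real_sqrt_divide)
    have v: "h (s * v) = sqrt (pi / e) * exp (- v\<^sup>2)" for v
      using s by (simp add: h_def e_def power_mult_distrib)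
    have "(LINT w|lborel. \<phi> w * h (w + a)) = \<bar>s\<bar> *\<^sub>R (LINT v|lborel. \<phi> (- a + s * v) * h (- a + s * v + a))"
      using s by (intro lborel_integral_real_affine) simp
    also have "\<dots> = s * (LINT v|lborel. sqrt (pi / e) * (\<phi> (- a + s * v) * exp (- v\<^sup>2)))"
      using s by (simp add: v mult.left_commute)
    also have "\<dots> = (s * sqrt (pi / e)) * (LINT v|lborel. \<phi> (- a + s * v) * exp (- v\<^sup>2))"
      by simp
    finally show "(LINT w|lborel. \<phi> w * h (w + a)) = 2 * sqrt pi * (LINT v|lborel. \<phi> (- a + s * v) * exp (- v\<^sup>2))"
      unfolding c .
  qed
  have split: "\<phi> w / 2 * (h (w - t) + h (w + t)) = \<phi> w * h (w + - t) / 2 + \<phi> w * h (w + t) / 2" for w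
    by (simp add: distrib_left add_divide_distrib)
  have "(LINT x|lborel. cos_transform \<phi> x * cos (t * x) * exp (- (e * x\<^sup>2))) =
      (LINT w|lborel. \<phi> w * h (w + - t) / 2 + \<phi> w * h (w + t) / 2)"
    using lborel_pair.Fubini_integral[OF F] unfolding inner outer split .
  also have "\<dots> = (LINT w|lborel. \<phi> w * h (w + - t)) / 2 + (LINT w|lborel. \<phi> w * h (w + t)) / 2"
    using h_int[of "- t"] h_int[of t] by (subst Bochner_Integration.integral_add) simp_all
  also have "\<dots> = sqrt pi * ((LINT v|lborel. \<phi> (t + s * v) * exp (- v\<^sup>2)) +
                 (LINT v|lborel. \<phi> (- t + s * v) * exp (- v\<^sup>2)))"
    unfolding h_eq by (simp add: distrib_left)
  finally show "(LINT x|lborel. cos_transform \<phi> x * cos (t * x) * exp (- (s\<^sup>2 / 4 * x\<^sup>2))) =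
      sqrt pi * ((LINT v|lborel. \<phi> (t + s * v) * exp (- v\<^sup>2)) +
                 (LINT v|lborel. \<phi> (- t + s * v) * exp (- v\<^sup>2)))"
    unfolding e_def .
qed

text \<open>At \<open>t = 0\<close> the nonnegative transform is multiplied by Gaussians increasing
  to \<open>1\<close>, so monotone convergence yields its integrability; dominated convergence then
  removes the Gaussian factor for every \<open>t\<close>.\<close>

lemma cos_transform_inversion:
  assumes \<phi>: "integrable lborel \<phi>" and cont: "\<And>w. isCont \<phi> w" and bound: "\<And>w. \<bar>\<phi> w\<bar> \<le> B"
    and even: "\<And>w. \<phi> (- w) = \<phi> w" and nonneg: "\<And>x. 0 \<le> cos_transform \<phi> x"
  shows "has_bochner_integral lborel (\<lambda>x. cos_transform \<phi> x * cos (t * x)) (2 * pi * \<phi> t)"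
proof -
  define s where "s n = inverse (real (Suc n))" for n
  have s: "s n > 0" for n by (simp add: s_def)
  have s0: "s \<longlonglongrightarrow> 0" unfolding s_def by (rule LIMSEQ_inverse_real_of_nat)
  have [measurable]: "\<phi> \<in> borel_measurable borel"
    using borel_measurable_integrable[OF \<phi>] by simp
  have [measurable]: "cos_transform \<phi> \<in> borel_measurable borel"
    by (intro borel_measurable_continuous_onI continuous_at_imp_continuous_on ballI isCont_cos_transform \<phi>)
  define g where "g n x = exp (- ((s n)\<^sup>2 / 4 * x\<^sup>2))" for n x
  have lim: "(\<lambda>n. LINT x|lborel. cos_transform \<phi> x * cos (t * x) * g n x) \<longlonglongrightarrow> 2 * pi * \<phi> t" for t
  proof -
    \<comment> \<open>The shrinking Gaussian acts as an approximate identity at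
      \<open>a\<close>.\<close>
    have "(\<lambda>n. LINT v|lborel. \<phi> (a + s n * v) * exp (- v\<^sup>2)) \<longlonglongrightarrow> (LINT v|lborel. \<phi> a * exp (- v\<^sup>2))" for a
    proof (rule integral_dominated_convergence[where w = "\<lambda>v. B * exp (- v\<^sup>2)"])
      show "AE v in lborel. (\<lambda>n. \<phi> (a + s n * v) * exp (- v\<^sup>2)) \<longlonglongrightarrow> \<phi> a * exp (- v\<^sup>2)"
      proof (intro always_eventually allI tendsto_mult tendsto_const)
        fix v
        have "(\<lambda>n. a + s n * v) \<longlonglongrightarrow> a + 0 * v" by (intro tendsto_intros s0)
        then show "(\<lambda>n. \<phi> (a + s n * v)) \<longlonglongrightarrow> \<phi> a"
          by (intro isCont_tendsto_compose[OF cont]) simp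
      qed
      show "AE v in lborel. norm (\<phi> (a + s n * v) * exp (- v\<^sup>2)) \<le> B * exp (- v\<^sup>2)" for n
        by (intro always_eventually allI) (simp add: abs_mult bound)
      show "integrable lborel (\<lambda>v::real. B * exp (- v\<^sup>2))"
        using integrable_gaussian[of 1] by simp
    qed measurable
    moreover have "(LINT v|lborel. \<phi> a * exp (- v\<^sup>2)) = \<phi> a * sqrt pi" for a
      using gaussian_cos[of 1 0] by (simp add: has_bochner_integral_iff)
    ultimately have A: "(\<lambda>n. LINT v|lborel. \<phi> (a + s n * v) * exp (- v\<^sup>2)) \<longlonglongrightarrow> \<phi> a * sqrt pi" for a
      by (simp only:)
    \<comment> \<open>Evenness merges the contributions of \<open>t\<close> and \<open>- t\<close>,
      which gives the factor 2.\<close>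
    have "sqrt pi * (\<phi> t * sqrt pi + \<phi> (- t) * sqrt pi) = 2 * (sqrt pi * sqrt pi) * \<phi> t"
      unfolding even by algebra
    then have C: "sqrt pi * (\<phi> t * sqrt pi + \<phi> (- t) * sqrt pi) = 2 * pi * \<phi> t"
      by simp
    show ?thesis
      using tendsto_mult[OF tendsto_const[of "sqrt pi"] tendsto_add[OF A[of t] A[of "- t"]]]
      unfolding C g_def cos_transform_gaussian_inversion(2)[OF \<phi> s] .
  qed
  have g_lim: "(\<lambda>n. g n x) \<longlonglongrightarrow> 1" for x
  proof -
    have "(\<lambda>n. g n x) \<longlonglongrightarrow> exp (- (0\<^sup>2 / 4 * x\<^sup>2))"
      unfolding g_def by (intro tendsto_intros s0) simp
    then show ?thesis by simp
  qed
  have g_le: "0 \<le> g n x" "g n x \<le> 1" for n x by (simp_all add: g_def)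
  have g_mono: "g n x \<le> g m x" if "n \<le> m" for n m x
  proof -
    have "s m \<le> s n" using that by (simp add: s_def)
    then have "(s m)\<^sup>2 * x\<^sup>2 \<le> (s n)\<^sup>2 * x\<^sup>2"
      using s[of m] by (intro mult_right_mono power_mono) auto
    then show ?thesis by (simp add: g_def)
  qed
  have int: "integrable lborel (cos_transform \<phi>)"
  proof (rule integrable_monotone_convergence)
    show "integrable lborel (\<lambda>x. cos_transform \<phi> x * g n x)" for n
      using cos_transform_gaussian_inversion(1)[OF \<phi> s, where t = 0] by (simp add: g_def)
    show "AE x in lborel. mono (\<lambda>n. cos_transform \<phi> x * g n x)"
      by (intro always_eventually allI monoI mult_left_mono g_mono nonneg)
    show "AE x in lborel. (\<lambda>n. cos_transform \<phi> x * g n x) \<longlonglongrightarrow> cos_transform \<phi> x"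
    proof (intro always_eventually allI)
      fix x show "(\<lambda>n. cos_transform \<phi> x * g n x) \<longlonglongrightarrow> cos_transform \<phi> x"
        using tendsto_mult[OF tendsto_const[of "cos_transform \<phi> x"] g_lim[of x]] by simp
    qed
    show "(\<lambda>n. LINT x|lborel. cos_transform \<phi> x * g n x) \<longlonglongrightarrow> 2 * pi * \<phi> 0"
      using lim[of 0] by simp
  qed measurable
  have "(\<lambda>n. LINT x|lborel. cos_transform \<phi> x * cos (t * x) * g n x) \<longlonglongrightarrow>
      (LINT x|lborel. cos_transform \<phi> x * cos (t * x))"
  proof (rule integral_dominated_convergence[OF _ _ int])
    show "AE x in lborel. (\<lambda>n. cos_transform \<phi> x * cos (t * x) * g n x) \<longlonglongrightarrow> cos_transform \<phi> x * cos (t * x)"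
    proof (intro always_eventually allI)
      fix x show "(\<lambda>n. cos_transform \<phi> x * cos (t * x) * g n x) \<longlonglongrightarrow> cos_transform \<phi> x * cos (t * x)"
        using tendsto_mult[OF tendsto_const[of "cos_transform \<phi> x * cos (t * x)"] g_lim[of x]] by simp
    qed
    show "AE x in lborel. norm (cos_transform \<phi> x * cos (t * x) * g n x) \<le> cos_transform \<phi> x" for n
    proof (intro always_eventually allI)
      fix x
      have "\<bar>cos (t * x)\<bar> * \<bar>g n x\<bar> \<le> 1" using g_le[of n x] by (intro mult_le_one) auto
      then show "norm (cos_transform \<phi> x * cos (t * x) * g n x) \<le> cos_transform \<phi> x"
        using nonneg[of x] by (simp add: abs_mult mult.assoc mult_left_le)
    qed
  qed (unfold g_def, measurable)
  then have "(LINT x|lborel. cos_transform \<phi> x * cos (t * x)) = 2 * pi * \<phi> t"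
    using lim by (rule LIMSEQ_unique)
  moreover have "integrable lborel (\<lambda>x. cos_transform \<phi> x * cos (t * x))"
    by (rule Bochner_Integration.integrable_bound[OF int])
      (simp_all add: abs_mult mult_left_le)
  ultimately show ?thesis by (simp add: has_bochner_integral_iff)
qed

section \<open>The stable densities and their properties\<close>

definition stable_density :: "real \<Rightarrow> real \<Rightarrow> real \<Rightarrow> real" where
  "stable_density \<alpha> \<gamma> x = cos_transform (stable_cf \<alpha> \<gamma>) x / (2 * pi)"

context
  fixes \<alpha> \<gamma> :: real
  assumes \<alpha>: "0 < \<alpha>" "\<alpha> \<le> 2" and \<gamma>: "0 < \<gamma>"
begin

lemma gmix_stable_density: "gmix (stable_density \<alpha> \<gamma>)"
  using gmix_cmult[OF _ gmix_stable[OF \<alpha> \<gamma>], of "1 / (2 * pi)"]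
  by (simp add: stable_density_def[abs_def])

lemma isCont_stable_density: "isCont (stable_density \<alpha> \<gamma>) x"
  unfolding stable_density_def
  by (intro continuous_intros isCont_cos_transform integrable_stable_cf \<alpha> \<gamma>) simp

lemma stable_density_measurable [measurable]: "stable_density \<alpha> \<gamma> \<in> borel_measurable borel"
  by (intro borel_measurable_continuous_onI continuous_at_imp_continuous_on ballI isCont_stable_density)

lemma stable_density_cos:
  "has_bochner_integral lborel (\<lambda>x. stable_density \<alpha> \<gamma> x * cos (t * x)) (stable_cf \<alpha> \<gamma> t)"
proof -
  have "has_bochner_integral lborel (\<lambda>x. cos_transform (stable_cf \<alpha> \<gamma>) x * cos (t * x))
      (2 * pi * stable_cf \<alpha> \<gamma> t)"
    using \<alpha> \<gamma> stable_cf_nonneg stable_cf_le_1 gmix_nonneg[OF gmix_stable[OF \<alpha> \<gamma>]]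
    by (intro cos_transform_inversion[where B = 1] integrable_stable_cf isCont_stable_cf stable_cf_minus)
      (simp_all add: abs_of_nonneg)
  from has_bochner_integral_mult_right[OF this, of "1 / (2 * pi)"]
  show ?thesis by (simp add: stable_density_def)
qed

lemma stable_density_integral: "has_bochner_integral lborel (stable_density \<alpha> \<gamma>) 1"
  using stable_density_cos[of 0] \<alpha> by (simp add: stable_cf_def)

text \<open>The density is even, so reflection maps the integral to its negative. This is the
  imaginary part of the characteristic function.\<close>

lemma stable_density_sin:
  "has_bochner_integral lborel (\<lambda>x. stable_density \<alpha> \<gamma> x * sin (t * x)) 0"
proof -
  let ?f = "\<lambda>x. stable_density \<alpha> \<gamma> x * sin (t * x)"
  have i: "integrable lborel ?f"
  proof (rule Bochner_Integration.integrable_bound)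
    show "integrable lborel (stable_density \<alpha> \<gamma>)"
      using stable_density_integral by (simp add: has_bochner_integral_iff)
  qed (auto simp: abs_mult mult_left_le)
  have "(LINT x|lborel. ?f x) = (LINT x|lborel. ?f (0 + - 1 * x))"
    by (subst lborel_integral_real_affine[of "- 1" _ 0]) simp_all
  also have "\<dots> = - (LINT x|lborel. ?f x)"
    by (simp add: gmix_minus[OF gmix_stable_density])
  finally show ?thesis using i by (simp add: has_bochner_integral_iff)
qed

text \<open>The cosine and sine integrals give the characteristic function, which determines the
  law.\<close>

lemma density_stable_density:
  "density lborel (\<lambda>x. ennreal (stable_density \<alpha> \<gamma> x)) = sym_stable \<alpha> \<gamma>"
proof -
  let ?M = "density lborel (\<lambda>x. ennreal (stable_density \<alpha> \<gamma> x))"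
  note nn = gmix_nonneg[OF gmix_stable_density]
  have "prob_space ?M"
  proof (rule prob_spaceI)
    show "emeasure ?M (space ?M) = 1"
      using nn_integral_eq_integral[of lborel "stable_density \<alpha> \<gamma>"] stable_density_integral nn
      by (simp add: emeasure_density has_bochner_integral_iff)
  qed
  then have "real_distribution ?M"
    by (simp add: real_distribution_def real_distribution_axioms_def)
  moreover have "char ?M t = complex_of_real (stable_cf \<alpha> \<gamma> t)" for t
  proof -
    have "char ?M t = (LINT x|lborel. stable_density \<alpha> \<gamma> x *\<^sub>R iexp (t * x))"
      unfolding char_def using nn by (subst integral_density) auto
    also have "\<dots> = (LINT x|lborel. complex_of_real (stable_density \<alpha> \<gamma> x * cos (t * x)) +
        \<i> * complex_of_real (stable_density \<alpha> \<gamma> x * sin (t * x)))"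
      by (intro Bochner_Integration.integral_cong refl)
        (simp add: complex_eq_iff Re_exp Im_exp)
    also have "\<dots> = complex_of_real (stable_cf \<alpha> \<gamma> t) + \<i> * complex_of_real 0"
      by (intro has_bochner_integral_integral_eq has_bochner_integral_add
          has_bochner_integral_mult_right has_bochner_integral_of_real
          stable_density_cos stable_density_sin)
    finally show ?thesis by simp
  qed
  ultimately show ?thesis
    by (intro sym_stable_eqI[symmetric]) (auto simp: stable_cf_def)
qed

lemma sym_stable_density_eq: "sym_stable_density \<alpha> \<gamma> = stable_density \<alpha> \<gamma>"
  by (intro sym_stable_density_eqI density_stable_density gmix_nonneg[OF gmix_stable_density]
      continuous_at_imp_continuous_on ballI isCont_stable_density)

text \<open>The value at the origin is the largest one; were it zero, the density would vanish
  identically, against total mass \<open>1\<close>. The rest is \<open>gmix_pos\<close>.\<close>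

lemma stable_density_pos: "0 < stable_density \<alpha> \<gamma> x"
proof (rule gmix_pos[OF gmix_stable_density isCont_stable_density])
  show "0 < stable_density \<alpha> \<gamma> 0"
  proof (rule ccontr)
    assume "\<not> ?thesis"
    then have "stable_density \<alpha> \<gamma> x = 0" for x
      using gmix_antimono[OF gmix_stable_density, of 0 x] gmix_nonneg[OF gmix_stable_density, of x] by simp
    then have "stable_density \<alpha> \<gamma> = (\<lambda>_. 0)"
      by (rule ext)
    then show False
      using has_bochner_integral_integral_eq[OF stable_density_integral] by simp
  qed
qed

text \<open>By monotonicity the rectangle over \<open>{0..x}\<close> with height the value at
  \<open>x\<close> lies below the graph, so its area is at most \<open>1\<close>.\<close>

lemma stable_density_tendsto_0: "(stable_density \<alpha> \<gamma> \<longlongrightarrow> 0) at_top"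
proof (rule tendsto_sandwich[OF _ _ tendsto_const])
  have "stable_density \<alpha> \<gamma> x \<le> 1 / x" if x: "x > 0" for x
  proof -
    have "(LINT y|lborel. stable_density \<alpha> \<gamma> x * indicator {0..x} y) \<le> (LINT y|lborel. stable_density \<alpha> \<gamma> y)"
    proof (rule integral_mono)
      show "integrable lborel (\<lambda>y. stable_density \<alpha> \<gamma> x * indicator {0..x} y)"
        by (intro integrable_mult_right integrable_real_indicator) (use x in auto)
      show "integrable lborel (stable_density \<alpha> \<gamma>)"
        using stable_density_integral by (simp add: has_bochner_integral_iff)
      show "stable_density \<alpha> \<gamma> x * indicator {0..x} y \<le> stable_density \<alpha> \<gamma> y" for y
        using gmix_antimono[OF gmix_stable_density, of y x] gmix_nonneg[OF gmix_stable_density, of y]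
        by (simp split: split_indicator)
    qed
    then have "stable_density \<alpha> \<gamma> x * x \<le> 1"
      using x has_bochner_integral_integral_eq[OF stable_density_integral] by simp
    then show ?thesis using x by (simp add: pos_le_divide_eq)
  qed
  then show "\<forall>\<^sub>F x in at_top. stable_density \<alpha> \<gamma> x \<le> 1 / x"
    by (rule eventually_mono[OF eventually_gt_at_top[of 0]])
  show "((\<lambda>x::real. 1 / x) \<longlongrightarrow> 0) at_top" by real_asymp
qed (use gmix_nonneg[OF gmix_stable_density] in simp)

lemma stable_density_strict_antimono:
  assumes "\<bar>x\<bar> < \<bar>y\<bar>"
  shows "stable_density \<alpha> \<gamma> y < stable_density \<alpha> \<gamma> x"
proof -
  have "stable_density \<alpha> \<gamma> \<bar>y\<bar> < stable_density \<alpha> \<gamma> \<bar>x\<bar>"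
    using assms by (intro gmix_strict_antimono[OF gmix_stable_density stable_density_pos
          stable_density_tendsto_0]) auto
  moreover have "stable_density \<alpha> \<gamma> \<bar>z\<bar> = stable_density \<alpha> \<gamma> z" for z
    using gmix_minus[OF gmix_stable_density, of z] by (cases "z \<ge> 0") simp_all
  ultimately show ?thesis by simp
qed

end

section \<open>Equidistribution of the quantization error\<close>

text \<open>The mode \<open>m\<close> given by \<open>unimodal\<close> may differ from
  \<open>0\<close>. For \<open>m \<ge> 0\<close> the increasing branch covers the negative half-line
  and is reflected; for \<open>m < 0\<close> the decreasing branch contains the positive
  half-line.\<close>

lemma unimodal_even_antimono:
  assumes "unimodal f" and even: "\<And>x. f (- x) = f x"
  shows "antimono_on {0<..} f"
proof -
  obtain m where m: "mono_on {..<m} f" "antimono_on {m<..} f"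
    using assms(1) unfolding unimodal_def by blast
  show ?thesis
  proof (cases "m \<ge> 0")
    case True
    show ?thesis
    proof (rule monotone_onI)
      fix x y :: real assume "x \<in> {0<..}" "y \<in> {0<..}" "x \<le> y"
      then have "f (- y) \<le> f (- x)"
        using True by (intro mono_onD[OF m(1)]) auto
      then show "f y \<le> f x" by (simp add: even)
    qed
  next
    case False
    then show ?thesis
      by (intro monotone_on_subset[OF m(2)]) auto
  qed
qed

text \<open>When \<open>x\<close> and \<open>x + h\<close> lie strictly on the same side of the
  origin, monotonicity turns the modulus into a signed difference that telescopes. The remaining
  \<open>x\<close> are charged to the mass of \<open>{- h..h}\<close>, so \<open>f\<close> may be
  unbounded near the origin.\<close>

lemma shift_L1_bound:
  fixes f :: "real \<Rightarrow> real"
  assumes f: "integrable lborel f" "\<And>x. 0 \<le> f x" "\<And>x. f (- x) = f x" "antimono_on {0<..} f"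
    and h: "0 \<le> h"
  shows "(LINT x|lborel. \<bar>f (x + h) - f x\<bar>) \<le> 4 * (LINT x|lborel. f x * indicator {- h..h} x)"
proof -
  have [measurable]: "f \<in> borel_measurable borel"
    using borel_measurable_integrable[OF f(1)] by simp
  have sh: "integrable lborel (\<lambda>x. g (x + h))" "(LINT x|lborel. g (x + h)) = (LINT x|lborel. g x)"
    if "integrable lborel g" for g :: "real \<Rightarrow> real"
    using lborel_integrable_real_affine[OF that, of 1 h] lborel_integral_real_affine[of 1 g h]
    by (simp_all add: add.commute)
  \<comment> \<open>\<open>G x - G (x + h)\<close> equals \<open>\<bar>f (x + h) - f x\<bar>\<close> off \<open>{- h..0}\<close> and has integral zero.\<close>
  define G where "G x = sgn x * f x" for x
  define K where "K x = f x * indicator {- h..h} x" for x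
  have G: "integrable lborel G"
    unfolding G_def by (rule Bochner_Integration.integrable_bound[OF f(1)])
      (auto simp: abs_mult abs_sgn_eq f(2))
  have K: "integrable lborel K"
    unfolding K_def by (rule Bochner_Integration.integrable_bound[OF f(1)])
      (auto simp: f(2) split: split_indicator)
  have anti: "f y \<le> f x" if "0 < x" "x \<le> y" for x y
    using monotone_onD[OF f(4), of x y] that by simp
  have anti': "f x \<le> f y" if "y < 0" "x \<le> y" for x y
    using anti[of "- y" "- x"] that by (simp add: f(3))
  have "(LINT x|lborel. \<bar>f (x + h) - f x\<bar>) \<le> (LINT x|lborel. G x - G (x + h) + 2 * (K x + K (x + h)))"
  proof (rule integral_mono)
    fix x
    consider "x > 0" | "x + h < 0" | "- h \<le> x" "x \<le> 0" by linarith
    then show "\<bar>f (x + h) - f x\<bar> \<le> G x - G (x + h) + 2 * (K x + K (x + h))"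
    proof cases
      case 1
      then have "\<bar>f (x + h) - f x\<bar> = G x - G (x + h)"
        using anti[of x "x + h"] h by (simp add: G_def)
      moreover have "0 \<le> K y" for y by (simp add: K_def f(2))
      ultimately show ?thesis by (simp add: add_nonneg_nonneg)
    next
      case 2
      then have "\<bar>f (x + h) - f x\<bar> = G x - G (x + h)"
        using anti'[of "x + h" x] h by (simp add: G_def)
      moreover have "0 \<le> K y" for y by (simp add: K_def f(2))
      ultimately show ?thesis by (simp add: add_nonneg_nonneg)
    next
      \<comment> \<open>Both points lie in \<open>{- h..h}\<close>; the coefficient 2 covers the
        differences of \<open>f\<close> and of \<open>G\<close>, each at most
        \<open>f x + f (x + h)\<close> in modulus.\<close>
      case 3
      then have "K x = f x" "K (x + h) = f (x + h)" using h by (auto simp: K_def)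
      moreover have "\<bar>G y\<bar> \<le> f y" for y
        by (simp add: G_def abs_mult abs_sgn_eq f(2))
      then have "- f x \<le> G x" "G (x + h) \<le> f (x + h)"
        by (simp_all add: abs_le_iff minus_le_iff)
      ultimately show ?thesis
        using f(2)[of x] f(2)[of "x + h"] by (intro abs_leI) simp_all
    qed
  qed (use f(1) G K sh(1) in auto)
  also have "\<dots> = 4 * (LINT x|lborel. K x)"
    using G K sh by simp
  finally show ?thesis unfolding K_def .
qed

text \<open>Dominated convergence along \<open>h = 1 / Suc n\<close>, the origin being a null set;
  monotonicity in \<open>h\<close> extends the limit to all small \<open>h\<close>.\<close>

lemma small_interval_mass:
  fixes f :: "real \<Rightarrow> real"
  assumes f: "integrable lborel f" "\<And>x. 0 \<le> f x"
  shows "((\<lambda>h. LINT x|lborel. f x * indicator {- h..h} x) \<longlongrightarrow> 0) (at_right 0)"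
proof (rule order_tendstoI)
  let ?K = "\<lambda>h. LINT x|lborel. f x * indicator {- h..h} x"
  have [measurable]: "f \<in> borel_measurable borel"
    using borel_measurable_integrable[OF f(1)] by simp
  have i: "integrable lborel (\<lambda>x. f x * indicator {- h..h} x)" for h
    by (rule Bochner_Integration.integrable_bound[OF f(1)])
      (auto simp: f(2) split: split_indicator)
  show "\<forall>\<^sub>F h in at_right 0. a < ?K h" if "a < 0" for a
    using that by (intro always_eventually allI less_le_trans[OF that] integral_nonneg) (simp add: f(2))
  have "(\<lambda>n. ?K (inverse (real (Suc n)))) \<longlonglongrightarrow> (LINT x|(lborel :: real measure). 0)"
  proof (rule integral_dominated_convergence[OF _ _ f(1)])
    show "AE x in lborel. (\<lambda>n. f x * indicator {- inverse (real (Suc n))..inverse (real (Suc n))} x) \<longlonglongrightarrow> 0"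
      using AE_lborel_singleton[of 0]
    proof eventually_elim
      case (elim x)
      have "\<forall>\<^sub>F n in sequentially. inverse (real (Suc n)) < \<bar>x\<bar>"
        using elim by (intro order_tendstoD[OF LIMSEQ_inverse_real_of_nat]) simp
      then have "\<forall>\<^sub>F n in sequentially. f x * indicator {- inverse (real (Suc n))..inverse (real (Suc n))} x = 0"
        by eventually_elim (auto split: split_indicator)
      then show ?case by (rule tendsto_eventually)
    qed
    show "AE x in lborel. norm (f x * indicator {- inverse (real (Suc n))..inverse (real (Suc n))} x) \<le> f x" for n
      by (auto simp: f(2) split: split_indicator)
  qed measurable
  then have *: "(\<lambda>n. ?K (inverse (real (Suc n)))) \<longlonglongrightarrow> 0" by simp
  fix e :: real assume "0 < e"
  then obtain n where n: "?K (inverse (real (Suc n))) < e"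
    using order_tendstoD(2)[OF * \<open>0 < e\<close>] by (auto simp: eventually_sequentially)
  have "?K h < e" if "h \<in> {0<..<inverse (real (Suc n))}" for h
  proof -
    have "?K h \<le> ?K (inverse (real (Suc n)))"
      using that by (intro integral_mono i) (auto simp: f(2) split: split_indicator)
    with n show ?thesis by simp
  qed
  then show "\<forall>\<^sub>F h in at_right 0. ?K h < e"
    by (intro eventually_at_rightI[of 0 "inverse (real (Suc n))"]) (blast, simp)
qed

section \<open>Centred fractional parts and averages over a period\<close>

definition centered_frac :: "real \<Rightarrow> real" where
  "centered_frac y = y - of_int \<lceil>y - 1 / 2\<rceil>"

lemma centered_frac_bounds: "- 1 / 2 < centered_frac y" "centered_frac y \<le> 1 / 2"
  unfolding centered_frac_def by linarith+

lemma centered_frac_measurable [measurable]: "centered_frac \<in> borel_measurable borel"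
  unfolding centered_frac_def by measurable

lemma centered_frac_eq: "- 1 / 2 < y - of_int k \<Longrightarrow> y - of_int k \<le> 1 / 2 \<Longrightarrow> centered_frac y = y - of_int k"
  unfolding centered_frac_def by (simp add: ceiling_eq_iff)

lemma integrable_bounded_interval:
  fixes \<psi> :: "real \<Rightarrow> real"
  assumes [measurable]: "\<psi> \<in> borel_measurable borel"
    and B: "\<And>v. a < v \<Longrightarrow> v \<le> b \<Longrightarrow> \<bar>\<psi> v\<bar> \<le> B"
  shows "integrable lborel (\<lambda>v. indicator {a<..b} v * \<psi> v)"
proof (rule Bochner_Integration.integrable_bound)
  show "integrable lborel (\<lambda>v. B * indicator {a..b} v)"
    by (intro integrable_mult_right integrable_real_indicator) (auto simp: emeasure_lborel_Icc_eq)
  show "AE v in lborel. norm (indicator {a<..b} v * \<psi> v) \<le> norm (B * indicator {a..b} v)"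
    using order_trans[OF B abs_ge_self] by (auto split: split_indicator)
qed simp

text \<open>While \<open>\<theta>\<close> runs over a unit interval, the centred fractional part
  traverses its range once, wrapping around at \<open>1 / 2\<close>.\<close>

lemma periodic_average:
  fixes \<psi> :: "real \<Rightarrow> real"
  assumes [measurable]: "\<psi> \<in> borel_measurable borel"
    and B: "\<And>v. - 1 / 2 < v \<Longrightarrow> v \<le> 1 / 2 \<Longrightarrow> \<bar>\<psi> v\<bar> \<le> B"
  shows "(LINT \<theta>|lborel. indicator {0..1} \<theta> * \<psi> (centered_frac (y + \<theta>))) =
     (LINT v|lborel. indicator {- 1 / 2<..1 / 2} v * \<psi> v)"
proof -
  define k where "k = \<lceil>y - 1 / 2\<rceil>"
  define r where "r = centered_frac y"
  have y: "y = r + of_int k" by (simp add: r_def k_def centered_frac_def)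
  have r: "- 1 / 2 < r" "r \<le> 1 / 2" unfolding r_def by (rule centered_frac_bounds)+
  \<comment> \<open>\<open>g1\<close> is the stretch before the wrap, from \<open>r\<close> up to
    \<open>1 / 2\<close>; \<open>g2\<close> is the one after it, from \<open>- 1 / 2\<close> back to
    \<open>r\<close>.\<close>
  define g1 where "g1 v = indicator {r<..1 / 2} v * \<psi> v" for v
  define g2 where "g2 v = indicator {- 1 / 2<..r} v * \<psi> v" for v
  have g1: "integrable lborel g1" and g2: "integrable lborel g2"
    unfolding g1_def g2_def using r by (intro integrable_bounded_interval[where B = B] assms; simp)+
  have "(LINT \<theta>|lborel. indicator {0..1} \<theta> * \<psi> (centered_frac (y + \<theta>))) =
      (LINT \<theta>|lborel. g1 (r + 1 * \<theta>) + g2 (r - 1 + 1 * \<theta>))"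
  proof (rule integral_cong_AE)
    show "AE \<theta> in lborel. indicator {0..1} \<theta> * \<psi> (centered_frac (y + \<theta>)) =
        g1 (r + 1 * \<theta>) + g2 (r - 1 + 1 * \<theta>)"
      \<comment> \<open>At \<open>\<theta> = 0\<close> both half-open pieces vanish, whatever the
        value of \<open>\<psi>\<close> at \<open>r\<close>; this null point is dropped.\<close>
      using AE_lborel_singleton[of 0]
    proof eventually_elim
      case (elim \<theta>)
      consider "\<theta> < 0 \<or> \<theta> > 1" | "0 < \<theta>" "r + \<theta> \<le> 1 / 2" | "r + \<theta> > 1 / 2" "\<theta> \<le> 1"
        using elim by linarith
      then show ?case
      proof cases
        case 1
        then show ?thesis using r by (auto simp: g1_def g2_def split: split_indicator)
      next
        case 2
        then have "centered_frac (y + \<theta>) = r + \<theta>"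
          using r centered_frac_eq[of "y + \<theta>" k] by (simp add: y)
        then show ?thesis using r 2 by (auto simp: g1_def g2_def split: split_indicator)
      next
        case 3
        then have "centered_frac (y + \<theta>) = r - 1 + \<theta>"
          using r centered_frac_eq[of "y + \<theta>" "k + 1"] by (simp add: y)
        then show ?thesis using r 3 by (auto simp: g1_def g2_def split: split_indicator)
      qed
    qed
  qed (unfold g1_def g2_def, measurable)
  also have "\<dots> = (LINT v|lborel. g1 v) + (LINT v|lborel. g2 v)"
    using lborel_integrable_real_affine[OF g1, of 1 r] lborel_integrable_real_affine[OF g2, of 1 "r - 1"]
      lborel_integral_real_affine[of 1 g1 r] lborel_integral_real_affine[of 1 g2 "r - 1"]
    by (subst Bochner_Integration.integral_add) simp_all
  also have "\<dots> = (LINT v|lborel. g1 v + g2 v)"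
    using g1 g2 by simp
  also have "\<dots> = (LINT v|lborel. indicator {- 1 / 2<..1 / 2} v * \<psi> v)"
    by (rule Bochner_Integration.integral_cong)
      (use r in \<open>auto simp: g1_def g2_def split: split_indicator\<close>)
  finally show ?thesis .
qed

text \<open>A shift by \<open>\<theta> * \<Delta>\<close> changes the integral by at most
  \<open>4 * B * K \<Delta>\<close>, uniformly in \<open>\<theta> \<in> {0..1}\<close>, while the
  mean over \<open>\<theta>\<close> is exactly the limit \<open>c\<close>.\<close>

lemma integral_periodic_tendsto:
  fixes f \<psi> :: "real \<Rightarrow> real"
  assumes f: "has_bochner_integral lborel f 1" "\<And>x. 0 \<le> f x" "\<And>x. f (- x) = f x" "antimono_on {0<..} f"
    and \<psi>[measurable]: "\<psi> \<in> borel_measurable borel"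
    and B: "\<And>v. - 1 / 2 < v \<Longrightarrow> v \<le> 1 / 2 \<Longrightarrow> \<bar>\<psi> v\<bar> \<le> B"
  shows "((\<lambda>\<Delta>. LINT x|lborel. f x * \<psi> (centered_frac (x / \<Delta>))) \<longlongrightarrow>
      (LINT v|lborel. indicator {- 1 / 2<..1 / 2} v * \<psi> v)) (at_right 0)"
proof -
  have int_f: "integrable lborel f" and int_1: "(LINT x|lborel. f x) = 1"
    using f(1) by (simp_all add: has_bochner_integral_iff)
  have [measurable]: "f \<in> borel_measurable borel"
    using borel_measurable_integrable[OF int_f] by simp
  define P where "P y = \<psi> (centered_frac y)" for y
  have [measurable]: "P \<in> borel_measurable borel"
    unfolding P_def by measurable
  have P: "\<bar>P y\<bar> \<le> B" for y
    unfolding P_def by (intro B centered_frac_bounds)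
  have B0: "0 \<le> B" using P[of 0] by simp
  define c where "c = (LINT v|lborel. indicator {- 1 / 2<..1 / 2} v * \<psi> v)"
  define K where "K h = (LINT x|lborel. f x * indicator {- h..h} x)" for h
  have int_mult: "integrable lborel (\<lambda>x. g x * P (q x))"
    if "integrable lborel g" "q \<in> borel_measurable borel" for g q :: "real \<Rightarrow> real"
  proof (rule Bochner_Integration.integrable_bound)
    show "integrable lborel (\<lambda>x. B * g x)" using that(1) by simp
    have [measurable]: "g \<in> borel_measurable borel" "q \<in> borel_measurable borel"
      using that borel_measurable_integrable[OF that(1)] by simp_all
    show "(\<lambda>x. g x * P (q x)) \<in> borel_measurable lborel" by measurable
    show "AE x in lborel. norm (g x * P (q x)) \<le> norm (B * g x)"
    proof (intro always_eventually allI)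
      fix x
      have "\<bar>g x\<bar> * \<bar>P (q x)\<bar> \<le> \<bar>g x\<bar> * B" by (intro mult_left_mono P) simp
      then show "norm (g x * P (q x)) \<le> norm (B * g x)"
        using B0 by (simp add: abs_mult mult.commute)
    qed
  qed
  have K_mono: "K h \<le> K h'" if "h \<le> h'" for h h'
    unfolding K_def
  proof (rule integral_mono)
    show "integrable lborel (\<lambda>x. f x * indicator {- h..h} x)" for h
      by (rule Bochner_Integration.integrable_bound[OF int_f])
        (auto simp: f(2) split: split_indicator)
    then show "integrable lborel (\<lambda>x. f x * indicator {- h'..h'} x)" .
    show "f x * indicator {- h..h} x \<le> f x * indicator {- h'..h'} x" for x
      using that by (auto simp: f(2) split: split_indicator)
  qed
  have bound: "\<bar>(LINT x|lborel. f x * P (x / \<Delta>)) - c\<bar> \<le> 4 * B * K \<Delta>" if \<Delta>: "0 < \<Delta>" for \<Delta>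
  proof -
    define E where "E = (LINT x|lborel. f x * P (x / \<Delta>))"
    define A where "A \<theta> = (LINT x|lborel. f x * P (x / \<Delta> + \<theta>))" for \<theta>
    have A_diff: "\<bar>E - A \<theta>\<bar> \<le> 4 * B * K \<Delta>" if \<theta>: "\<theta> \<in> {0..1}" for \<theta>
    proof -
      have shift: "integrable lborel (\<lambda>x. f (x + \<theta> * \<Delta>))"
        using lborel_integrable_real_affine[OF int_f, of 1 "\<theta> * \<Delta>"] by (simp add: add.commute)
      \<comment> \<open>Translating the variable lets the two integrals share the same periodic
        factor and differ only in the density.\<close>
      have "E = (LINT x|lborel. f (x + \<theta> * \<Delta>) * P (x / \<Delta> + \<theta>))"
        using \<Delta> unfolding E_def
        by (subst lborel_integral_real_affine[of 1 _ "\<theta> * \<Delta>"]) (simp_all add: add_divide_distrib add.commute)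
      then have "E - A \<theta> = (LINT x|lborel. f (x + \<theta> * \<Delta>) * P (x / \<Delta> + \<theta>) - f x * P (x / \<Delta> + \<theta>))"
        unfolding A_def using int_mult[OF shift, of "\<lambda>x. x / \<Delta> + \<theta>"] int_mult[OF int_f, of "\<lambda>x. x / \<Delta> + \<theta>"]
        by (subst Bochner_Integration.integral_diff) simp_all
      then have "\<bar>E - A \<theta>\<bar> = \<bar>LINT x|lborel. (f (x + \<theta> * \<Delta>) - f x) * P (x / \<Delta> + \<theta>)\<bar>"
        by (simp add: left_diff_distrib)
      also have "\<dots> \<le> (LINT x|lborel. \<bar>(f (x + \<theta> * \<Delta>) - f x) * P (x / \<Delta> + \<theta>)\<bar>)"
        by (rule integral_abs_bound)
      also have "\<dots> \<le> (LINT x|lborel. \<bar>f (x + \<theta> * \<Delta>) - f x\<bar> * B)"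
      proof (rule integral_mono)
        show "\<bar>(f (x + \<theta> * \<Delta>) - f x) * P (x / \<Delta> + \<theta>)\<bar> \<le> \<bar>f (x + \<theta> * \<Delta>) - f x\<bar> * B" for x
          unfolding abs_mult by (intro mult_left_mono P) simp
        show "integrable lborel (\<lambda>x. \<bar>(f (x + \<theta> * \<Delta>) - f x) * P (x / \<Delta> + \<theta>)\<bar>)"
          using shift int_f by (intro integrable_abs int_mult) auto
      qed (use shift int_f in auto)
      also have "\<dots> = B * (LINT x|lborel. \<bar>f (x + \<theta> * \<Delta>) - f x\<bar>)"
        by simp
      also have "\<dots> \<le> B * (4 * K (\<theta> * \<Delta>))"
        using \<theta> \<Delta> unfolding K_def
        by (intro mult_left_mono shift_L1_bound int_f f(2-4) B0) simp
      also have "\<dots> \<le> B * (4 * K \<Delta>)"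
        using \<theta> \<Delta> by (intro mult_left_mono K_mono B0) simp_all
      finally show ?thesis by simp
    qed
    have int_pair: "integrable (lborel \<Otimes>\<^sub>M lborel)
        (\<lambda>(\<theta>, x). indicator {0..1} \<theta> * (f x * P (x / \<Delta> + \<theta>)))"
    proof (rule integrable_product_bound)
      show "integrable lborel (\<lambda>\<theta>. B * indicator {0..1::real} \<theta>)"
        by (intro integrable_mult_right integrable_real_indicator) auto
      show "integrable lborel f" by (rule int_f)
      show "(\<lambda>(\<theta>, x). indicator {0..1} \<theta> * (f x * P (x / \<Delta> + \<theta>))) \<in> borel_measurable borel"
        by (subst borel_prod[symmetric]) measurable
      fix \<theta> x :: real
      have "f x * \<bar>P (x / \<Delta> + \<theta>)\<bar> \<le> f x * B"
        by (intro mult_left_mono P f(2))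
      then show "\<bar>case (\<theta>, x) of (\<theta>, x) \<Rightarrow> indicator {0..1} \<theta> * (f x * P (x / \<Delta> + \<theta>))\<bar> \<le> B * indicator {0..1} \<theta> * f x"
        by (simp add: abs_mult f(2) mult.commute split: split_indicator)
    qed
    have avg: "(LINT \<theta>|lborel. indicator {0..1} \<theta> * A \<theta>) = c"
    proof -
      have "(LINT \<theta>|lborel. indicator {0..1} \<theta> * A \<theta>) =
          (LINT \<theta>|lborel. LINT x|lborel. indicator {0..1} \<theta> * (f x * P (x / \<Delta> + \<theta>)))"
        by (simp add: A_def)
      \<comment> \<open>With \<open>\<theta>\<close> integrated first, the inner integral is a
        full-period average, the same for every \<open>x\<close>.\<close>
      also have "\<dots> = (LINT x|lborel. LINT \<theta>|lborel. indicator {0..1} \<theta> * (f x * P (x / \<Delta> + \<theta>)))"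
        by (rule lborel_pair.Fubini_integral[OF int_pair, symmetric])
      also have "\<dots> = (LINT x|lborel. f x * (LINT \<theta>|lborel. indicator {0..1} \<theta> * P (x / \<Delta> + \<theta>)))"
        by (simp add: mult.left_commute)
      also have "\<dots> = (LINT x|lborel. f x * c)"
        unfolding P_def c_def using periodic_average[OF \<psi> B] by simp
      also have "\<dots> = c" using int_1 by simp
      finally show ?thesis .
    qed
    have int_A: "integrable lborel (\<lambda>\<theta>. indicator {0..1} \<theta> * A \<theta>)"
      using lborel_pair.integrable_fst[OF int_pair] by (simp add: A_def)
    have int_E: "integrable lborel (\<lambda>\<theta>. indicator {0..1::real} \<theta> * e)" for e :: real
      by (intro integrable_mult_left integrable_real_indicator) auto
    \<comment> \<open>The interval \<open>{0..1}\<close> has length one, so the constant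
      \<open>E\<close> is its own average.\<close>
    have "E - c = (LINT \<theta>|lborel. indicator {0..1} \<theta> * E - indicator {0..1} \<theta> * A \<theta>)"
      using int_A int_E[of E] avg by (simp add: Bochner_Integration.integral_diff)
    then have "\<bar>E - c\<bar> = \<bar>LINT \<theta>|lborel. indicator {0..1} \<theta> * (E - A \<theta>)\<bar>"
      by (simp add: right_diff_distrib)
    also have "\<dots> \<le> (LINT \<theta>|lborel. \<bar>indicator {0..1} \<theta> * (E - A \<theta>)\<bar>)"
      by (rule integral_abs_bound)
    also have "\<dots> \<le> (LINT \<theta>|lborel. indicator {0..1::real} \<theta> * (4 * B * K \<Delta>))"
    proof (rule integral_mono)
      show "integrable lborel (\<lambda>\<theta>. \<bar>indicator {0..1} \<theta> * (E - A \<theta>)\<bar>)"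
        using int_A int_E[of E] by (simp add: right_diff_distrib)
      show "integrable lborel (\<lambda>\<theta>. indicator {0..1::real} \<theta> * (4 * B * K \<Delta>))"
        by (rule int_E)
      show "\<bar>indicator {0..1} \<theta> * (E - A \<theta>)\<bar> \<le> indicator {0..1} \<theta> * (4 * B * K \<Delta>)" for \<theta>
        using A_diff[of \<theta>] by (simp split: split_indicator)
    qed
    also have "\<dots> = 4 * B * K \<Delta>" by simp
    finally show ?thesis unfolding E_def .
  qed
  have "((\<lambda>\<Delta>. 4 * B * K \<Delta>) \<longlongrightarrow> 4 * B * 0) (at_right 0)"
    unfolding K_def by (intro tendsto_intros small_interval_mass int_f f(2))
  then have "((\<lambda>\<Delta>. 4 * B * K \<Delta>) \<longlongrightarrow> 0) (at_right 0)"
    by simp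
  moreover have "\<forall>\<^sub>F \<Delta> in at_right 0. norm ((LINT x|lborel. f x * P (x / \<Delta>)) - c) \<le> 4 * B * K \<Delta>"
    using eventually_at_right_less[of 0] by eventually_elim (simp add: bound)
  ultimately have "((\<lambda>\<Delta>. (LINT x|lborel. f x * P (x / \<Delta>)) - c) \<longlongrightarrow> 0) (at_right 0)"
    by (rule Lim_null_comparison[rotated])
  then show ?thesis
    unfolding c_def P_def by (rule LIM_zero_cancel)
qed

section \<open>Convergence of infima under rescaling\<close>

lemma scaled_INF_tendsto:
  fixes G :: "real \<Rightarrow> real" and Q :: "real \<Rightarrow> real \<Rightarrow> real"
  assumes mono: "\<And>\<Delta> s t. 0 < \<Delta> \<Longrightarrow> 0 < s \<Longrightarrow> s \<le> t \<Longrightarrow> Q \<Delta> s \<le> Q \<Delta> t"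
    and strict: "\<And>s t. 0 < s \<Longrightarrow> s < t \<Longrightarrow> G s < G t"
    and lim: "\<And>s. 0 < s \<Longrightarrow> ((\<lambda>\<Delta>. Q \<Delta> s) \<longlongrightarrow> G s) (at_right 0)"
  shows "((\<lambda>\<Delta>. (INF s\<in>{s. 0 < s \<and> c \<le> Q \<Delta> (s / \<Delta>)}. ereal s) / ereal \<Delta>) \<longlongrightarrow>
      (INF s\<in>{s. 0 < s \<and> c \<le> G s}. ereal s)) (at_right 0)"
proof (rule order_tendstoI)
  let ?I = "\<lambda>\<Delta>. INF s\<in>{s. 0 < s \<and> c \<le> Q \<Delta> (s / \<Delta>)}. ereal s"
  have pos: "\<forall>\<^sub>F \<Delta> in at_right 0. 0 < (\<Delta> :: real)"
    by (rule eventually_at_right_less)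
  fix a assume "a < (INF s\<in>{s. 0 < s \<and> c \<le> G s}. ereal s)"
  then obtain b where b: "a < ereal b" "ereal b < (INF s\<in>{s. 0 < s \<and> c \<le> G s}. ereal s)"
    using ereal_dense2 by blast
  \<comment> \<open>The sets contain positive numbers only, which settles \<open>b \<le> 0\<close>.
    Otherwise \<open>b\<close> is outside the limiting set, and monotonicity turns
    \<open>Q \<Delta> b < c\<close> into a lower bound \<open>b\<close> for all
    \<open>s / \<Delta>\<close>.\<close>
  have "\<forall>\<^sub>F \<Delta> in at_right 0. b \<le> 0 \<or> Q \<Delta> b < c"
  proof (cases "b \<le> 0")
    case False
    have "G b < c"
    proof (rule ccontr)
      assume "\<not> ?thesis"
      then have "(INF s\<in>{s. 0 < s \<and> c \<le> G s}. ereal s) \<le> ereal b"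
        using False by (intro INF_lower) auto
      with b(2) show False by simp
    qed
    then have "\<forall>\<^sub>F \<Delta> in at_right 0. Q \<Delta> b < c"
      using False by (intro order_tendstoD(2)[OF lim]) auto
    then show ?thesis by eventually_elim simp
  qed simp
  then show "\<forall>\<^sub>F \<Delta> in at_right 0. a < ?I \<Delta> / ereal \<Delta>"
    using pos
  proof eventually_elim
    case (elim \<Delta>)
    have "ereal (b * \<Delta>) \<le> ?I \<Delta>"
    proof (rule INF_greatest)
      fix s assume s: "s \<in> {s. 0 < s \<and> c \<le> Q \<Delta> (s / \<Delta>)}"
      have "b \<le> s / \<Delta>"
      proof (rule ccontr)
        assume "\<not> b \<le> s / \<Delta>"
        moreover have "0 < s / \<Delta>" using s elim by simp
        ultimately have "Q \<Delta> (s / \<Delta>) \<le> Q \<Delta> b" "0 < b" using elim by (auto intro!: mono)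
        then show False using s elim by auto
      qed
      then show "ereal (b * \<Delta>) \<le> ereal s" using elim by (simp add: pos_le_divide_eq)
    qed
    then have "ereal (b * \<Delta>) / ereal \<Delta> \<le> ?I \<Delta> / ereal \<Delta>"
      using elim by (intro ereal_divide_right_mono) auto
    then show ?case using b(1) elim by simp
  qed
next
  let ?I = "\<lambda>\<Delta>. INF s\<in>{s. 0 < s \<and> c \<le> Q \<Delta> (s / \<Delta>)}. ereal s"
  fix a assume "(INF s\<in>{s. 0 < s \<and> c \<le> G s}. ereal s) < a"
  then obtain s where s: "0 < s" "c \<le> G s" "ereal s < a"
    unfolding INF_less_iff by auto
  then obtain b where b: "ereal s < ereal b" "ereal b < a"
    using ereal_dense2 by blast
  \<comment> \<open>At \<open>s\<close> there may be equality, which does not pass to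
    \<open>Q \<Delta>\<close>; moving up to \<open>b\<close> makes the inequality strict, hence
    valid for small \<open>\<Delta>\<close>.\<close>
  have "c < G b" using strict[of s b] s b by simp
  then have "\<forall>\<^sub>F \<Delta> in at_right 0. c < Q \<Delta> b"
    using s b by (intro order_tendstoD(1)[OF lim]) auto
  then show "\<forall>\<^sub>F \<Delta> in at_right 0. ?I \<Delta> / ereal \<Delta> < a"
    using eventually_at_right_less[of 0]
  proof eventually_elim
    case (elim \<Delta>)
    have "?I \<Delta> \<le> ereal (b * \<Delta>)"
      using elim s b by (intro INF_lower) auto
    then have "?I \<Delta> / ereal \<Delta> \<le> ereal (b * \<Delta>) / ereal \<Delta>"
      using elim by (intro ereal_divide_right_mono) auto
    then show ?case using b(2) elim by simp
  qed
qed

section \<open>Convergence of the strengths\<close>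

theorem theorem5:
  fixes \<alpha> :: real and M :: "'a measure" and X :: "'a \<Rightarrow> real" and f :: "real \<Rightarrow> real"
    and N :: "'b measure" and U :: "'b \<Rightarrow> real"
  assumes "0 < \<alpha>" and "\<alpha> \<le> 2"
    and "prob_space M"
    and "distributed M lborel X (\<lambda>x. ennreal (f x))" and "\<And>x. 0 \<le> f x"
    and "unimodal f" and "\<And>x. f (- x) = f x"
    and "strength \<alpha> M X < \<infinity>"
    and "prob_space N" and "U \<in> borel_measurable N"
    and "distr N lborel U = uniform_measure lborel {- 1 / 2 <..< 1 / 2}"
  shows "((\<lambda>\<Delta>. strength \<alpha> M (\<lambda>\<omega>. X \<omega> - quantize \<Delta> (X \<omega>)) / ereal \<Delta>)
           \<longlongrightarrow> strength \<alpha> N U) (at_right 0)"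
proof -
  interpret M: prob_space M by fact
  interpret N: prob_space N by fact
  define p where "p = ref_density \<alpha>"
  define L where "L x = ln (p x)" for x
  have \<gamma>: "0 < (1 / \<alpha>) powr (1 / \<alpha>)" using assms(1) by simp
  note \<alpha> = assms(1,2)
  have p: "p = stable_density \<alpha> ((1 / \<alpha>) powr (1 / \<alpha>))"
    unfolding p_def by (rule sym_stable_density_eq[OF \<alpha> \<gamma>])
  have p_pos: "0 < p x" for x
    unfolding p by (rule stable_density_pos[OF \<alpha> \<gamma>])
  have L_cont: "isCont L x" for x
    unfolding L_def using isCont_stable_density[OF \<alpha> \<gamma>] p_pos[of x]
    by (intro isCont_ln') (simp_all add: p)
  have L_meas [measurable]: "L \<in> borel_measurable borel"
    by (intro borel_measurable_continuous_onI continuous_at_imp_continuous_on ballI L_cont)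
  have L_less: "L y < L x" if "\<bar>x\<bar> < \<bar>y\<bar>" for x y
    using stable_density_strict_antimono[OF \<alpha> \<gamma> that] p_pos unfolding L_def p by simp
  have L_le: "L y \<le> L x" if "\<bar>x\<bar> \<le> \<bar>y\<bar>" for x y
    using gmix_antimono[OF gmix_stable_density[OF \<alpha> \<gamma>] that] p_pos unfolding L_def p by simp
  \<comment> \<open>\<open>L\<close> decreases in the modulus of its argument, so for
    \<open>v\<close> in \<open>{- 1 / 2..1 / 2}\<close> its values at \<open>v / s\<close> lie
    between those at \<open>1 / (2 * s)\<close> and at \<open>0\<close>.\<close>
  define B where "B s = max \<bar>L 0\<bar> \<bar>L (1 / (2 * s))\<bar>" for s
  have L_bound: "\<bar>L (v / s)\<bar> \<le> B s" if "0 < s" "- 1 / 2 \<le> v" "v \<le> 1 / 2" for v s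
  proof -
    have "\<bar>v / s\<bar> \<le> \<bar>1 / (2 * s)\<bar>"
      using that by (auto simp: abs_divide abs_le_iff divide_simps)
    then have "L (1 / (2 * s)) \<le> L (v / s)" by (rule L_le)
    moreover have "L (v / s) \<le> L 0" by (rule L_le) simp
    ultimately show ?thesis unfolding B_def by linarith
  qed
  have L_int: "integrable R (\<lambda>\<omega>. L (Y \<omega> / s))"
    if "prob_space R" "Y \<in> borel_measurable R" "0 < s" "AE \<omega> in R. - 1 / 2 \<le> Y \<omega> \<and> Y \<omega> \<le> 1 / 2"
    for R :: "'c measure" and Y s
  proof -
    interpret R: prob_space R by fact
    have [measurable]: "Y \<in> borel_measurable R" by fact
    show ?thesis
    proof (rule R.integrable_const_bound[where B = "B s"])
      show "AE \<omega> in R. norm (L (Y \<omega> / s)) \<le> B s"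
        using that(4) by eventually_elim (use L_bound that(3) in simp)
    qed measurable
  qed
  define G where "G s = (LINT v|lborel. indicator {- 1 / 2<..1 / 2} v * L (v / s))" for s
  define Q where "Q \<Delta> s = (LINT x|lborel. f x * L (centered_frac (x / \<Delta>) / s))" for \<Delta> s
  define c where "c = - diff_entropy p"

  have f_meas [measurable]: "f \<in> borel_measurable borel"
    using distributed_real_measurable[OF assms(5,4)] by simp
  have f_int: "has_bochner_integral lborel f 1"
    using distributed_integrable[OF assms(4), of "\<lambda>_. 1"] distributed_integral[OF assms(4), of "\<lambda>_. 1"]
    by (simp add: has_bochner_integral_iff assms(5) M.prob_space)
  have f_int': "integrable lborel f" using f_int by (simp add: has_bochner_integral_iff)
  have X_meas [measurable]: "X \<in> borel_measurable M"
    using distributed_measurable[OF assms(4)] by simp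
  have Q_int: "integrable lborel (\<lambda>x. f x * L (centered_frac (x / \<Delta>) / s))" if "0 < s" for \<Delta> s
  proof (rule Bochner_Integration.integrable_bound)
    show "integrable lborel (\<lambda>x. B s * f x)" using f_int' by simp
    show "AE x in lborel. norm (f x * L (centered_frac (x / \<Delta>) / s)) \<le> norm (B s * f x)"
    proof (intro always_eventually allI)
      fix x
      have b: "\<bar>L (centered_frac (x / \<Delta>) / s)\<bar> \<le> B s"
        using that centered_frac_bounds[of "x / \<Delta>"] by (intro L_bound) auto
      then have "f x * \<bar>L (centered_frac (x / \<Delta>) / s)\<bar> \<le> f x * \<bar>B s\<bar>"
        by (intro mult_left_mono assms(5)) simp
      then show "norm (f x * L (centered_frac (x / \<Delta>) / s)) \<le> norm (B s * f x)"
        using assms(5)[of x] by (simp add: abs_mult mult.commute)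
    qed
  qed measurable
  have X_strength: "strength \<alpha> M (\<lambda>\<omega>. X \<omega> - quantize \<Delta> (X \<omega>)) =
      (INF s\<in>{s. 0 < s \<and> c \<le> Q \<Delta> (s / \<Delta>)}. ereal s)" if \<Delta>: "0 < \<Delta>" for \<Delta>
  proof -
    \<comment> \<open>The half-open quantization regions match the range of
      \<open>centered_frac\<close>, so the identity holds at every point; the scale \<open>s\<close>
      becomes \<open>s / \<Delta>\<close>.\<close>
    have err: "(X \<omega> - quantize \<Delta> (X \<omega>)) / s = centered_frac (X \<omega> / \<Delta>) / (s / \<Delta>)" for \<omega> s
      using \<Delta> by (simp add: quantize_ceiling centered_frac_def diff_divide_distrib left_diff_distrib)
    have "integrable M (\<lambda>\<omega>. L (centered_frac (X \<omega> / \<Delta>) / (s / \<Delta>)))" if "0 < s" for s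
    proof (rule L_int)
      show "AE \<omega> in M. - 1 / 2 \<le> centered_frac (X \<omega> / \<Delta>) \<and> centered_frac (X \<omega> / \<Delta>) \<le> 1 / 2"
        by (intro always_eventually allI conjI less_imp_le[OF centered_frac_bounds(1)] centered_frac_bounds(2))
    qed (use that \<Delta> M.prob_space_axioms in auto)
    moreover have "(LINT \<omega>|M. L (centered_frac (X \<omega> / \<Delta>) / (s / \<Delta>))) = Q \<Delta> (s / \<Delta>)" for s
      unfolding Q_def
      by (rule distributed_integral[OF assms(4), symmetric]) (simp_all add: assms(5))
    \<comment> \<open>The error is bounded, so the integrability clause holds for every
      \<open>s > 0\<close> and only the inequality remains.\<close>
    ultimately have "{s. 0 < s \<and> integrable M (\<lambda>\<omega>. L ((X \<omega> - quantize \<Delta> (X \<omega>)) / s)) \<and>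
         - (LINT \<omega>|M. L ((X \<omega> - quantize \<Delta> (X \<omega>)) / s)) \<le> diff_entropy p} =
        {s. 0 < s \<and> c \<le> Q \<Delta> (s / \<Delta>)}"
      unfolding err c_def by (auto simp: minus_le_iff)
    then show ?thesis
      unfolding strength_def L_def p_def by simp
  qed
  have [measurable]: "U \<in> borel_measurable N" by fact
  \<comment> \<open>Excluding \<open>0\<close> serves the strict monotonicity of \<open>G\<close>:
    rescaling does not move the point \<open>0\<close>.\<close>
  have AE_U: "AE \<omega> in N. - 1 / 2 \<le> U \<omega> \<and> U \<omega> \<le> 1 / 2 \<and> U \<omega> \<noteq> 0"
  proof -
    have "AE v in uniform_measure lborel {- 1 / 2<..<1 / 2::real}. - 1 / 2 \<le> v \<and> v \<le> 1 / 2 \<and> v \<noteq> 0"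
      using AE_lborel_singleton[of 0] by (intro AE_uniform_measureI) (auto elim: eventually_mono)
    then show ?thesis
      unfolding assms(11)[symmetric] by (subst (asm) AE_distr_iff) simp_all
  qed
  have U_int: "integrable N (\<lambda>\<omega>. L (U \<omega> / s))" if "0 < s" for s
    using AE_U that by (intro L_int N.prob_space_axioms) (auto elim: eventually_mono)
  have U_expectation: "(LINT \<omega>|N. L (U \<omega> / s)) = G s" for s
  proof -
    have "(LINT \<omega>|N. L (U \<omega> / s)) = (LINT v|distr N lborel U. L (v / s))"
      by (subst integral_distr) simp_all
    also have "\<dots> = (LINT v|density lborel (\<lambda>v. ennreal (indicator {- 1 / 2<..<1 / 2} v)). L (v / s))"
      unfolding assms(11) uniform_measure_def
      by (simp add: ennreal_indicator divide_ennreal_def)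
    also have "\<dots> = (LINT v|lborel. indicator {- 1 / 2<..<1 / 2} v * L (v / s))"
      by (subst integral_real_density) simp_all
    \<comment> \<open>The open interval of the uniform law and the half-open range of
      \<open>centered_frac\<close> differ by the null point \<open>1 / 2\<close>.\<close>
    also have "\<dots> = G s"
      unfolding G_def
    proof (rule integral_cong_AE)
      show "AE v in lborel. indicator {- 1 / 2<..<1 / 2} v * L (v / s) = indicator {- 1 / 2<..1 / 2} v * L (v / s)"
        using AE_lborel_singleton[of "1 / 2"] by eventually_elim (simp split: split_indicator)
    qed measurable
    finally show ?thesis .
  qed
  have U_strength: "strength \<alpha> N U = (INF s\<in>{s. 0 < s \<and> c \<le> G s}. ereal s)"
  proof -
    have "{s. 0 < s \<and> integrable N (\<lambda>\<omega>. L (U \<omega> / s)) \<and> - (LINT \<omega>|N. L (U \<omega> / s)) \<le> diff_entropy p} =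
        {s. 0 < s \<and> c \<le> G s}"
      unfolding U_expectation c_def using U_int by (auto simp: minus_le_iff)
    then show ?thesis
      unfolding strength_def L_def p_def by simp
  qed
  have "((\<lambda>\<Delta>. (INF s\<in>{s. 0 < s \<and> c \<le> Q \<Delta> (s / \<Delta>)}. ereal s) / ereal \<Delta>) \<longlongrightarrow>
      strength \<alpha> N U) (at_right 0)"
    unfolding U_strength
  proof (rule scaled_INF_tendsto)
    fix \<Delta> s t :: real assume st: "0 < s" "s \<le> t"
    show "Q \<Delta> s \<le> Q \<Delta> t"
      unfolding Q_def
    proof (rule integral_mono)
      fix x
      have "\<bar>centered_frac (x / \<Delta>) / t\<bar> \<le> \<bar>centered_frac (x / \<Delta>) / s\<bar>"
        using st by (auto simp: abs_divide intro!: divide_left_mono)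
      then show "f x * L (centered_frac (x / \<Delta>) / s) \<le> f x * L (centered_frac (x / \<Delta>) / t)"
        by (intro mult_left_mono L_le assms(5))
    qed (use st Q_int in auto)
  next
    fix s t :: real assume st: "0 < s" "s < t"
    show "G s < G t"
      unfolding U_expectation[symmetric]
    proof (rule N.integral_less_AE_space)
      show "AE \<omega> in N. L (U \<omega> / s) < L (U \<omega> / t)"
        using AE_U
      proof eventually_elim
        case (elim \<omega>)
        then have "\<bar>U \<omega> / t\<bar> < \<bar>U \<omega> / s\<bar>"
          using st by (simp add: abs_divide divide_strict_left_mono)
        then show ?case by (rule L_less)
      qed
      show "emeasure N (space N) \<noteq> 0" by (simp add: N.emeasure_space_1)
    qed (use U_int st in auto)
  next
    fix s :: real assume s: "0 < s"
    show "((\<lambda>\<Delta>. Q \<Delta> s) \<longlongrightarrow> G s) (at_right 0)"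
      unfolding Q_def G_def
    proof (rule integral_periodic_tendsto[where \<psi> = "\<lambda>v. L (v / s)" and B = "B s"])
      show "antimono_on {0<..} f"
        by (rule unimodal_even_antimono) fact+
      show "\<bar>L (v / s)\<bar> \<le> B s" if "- 1 / 2 < v" "v \<le> 1 / 2" for v
        using s that by (intro L_bound) auto
    qed (use f_int assms(5,7) in auto)
  qed
  then show ?thesis
    \<comment> \<open>The formula for the strength of the error holds for
      \<open>\<Delta> > 0\<close>, hence eventually in \<open>at_right 0\<close>.\<close>
    by (rule Lim_transform_eventually)
      (use X_strength in \<open>auto intro!: eventually_mono[OF eventually_at_right_less[of 0]]\<close>)
qed

end
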